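(* Suppose \textsf{MonoConvolution} on sequences of length $n$ can be solved in $T(n)$ time. Then \textsf{CoinChange} with values up to $n$ can be solved in $O(T(n)\log^2 n)$ time.
   Context: \textsf{MonoConvolution}: given three integer sequences $a,b,c$ of length $n$ (indexed $0,\dots,n-1$), compute the sequence $d$ with $d_i=1$ if there exists $j$ (with $0\le j\le i$) such that $a_j=b_{i-j}=c_i$, and $d_i=0$ otherwise. \textsf{CoinChange}: given a set of coin values $C\subseteq\{1,2,\dots,n\}$, with an unlimited supply of coins of each value in $C$, determine for each $v\in\{1,2,\dots,n\}$ the minimum number of coins (repetitions allowed) whose values sum to $v$ (or $\infty$ if none). Running times are measured in the word-RAM model with $O(\log n)$-bit words. *)

theory Defs
  imports
    Complex_Main
    "HOL-Library.Extended_Nat"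
    "HOL-Library.Multiset"
    "HOL-Library.Landau_Symbols"
begin

section \<open>The word RAM\<close>

text \<open>
  A machine has registers and a memory that is addressed indirectly through registers; both hold
  signed words. Programs are structured: in place of jumps there are conditionals and while loops.
  This changes running times by at most a constant factor, because a program with jumps can keep
  its program counter in a register and branch over its finitely many values.

  Overflow is a fault: an instruction whose result is not a \<open>w\<close>-bit word has no successor state.
  Since the number of bits is only fixed up to a constant factor, this is no restriction compared
  with wrap-around arithmetic, which can be carried out on words of twice the length.
\<close>

datatype binop = Add | Sub | Mul | Quot | Rem | BAnd | BOr | BXor | Shl | Shr | Eq | Lt

fun binop_val :: "binop \<Rightarrow> int \<Rightarrow> int \<Rightarrow> int" where
  "binop_val Add x y = x + y"
| "binop_val Sub x y = x - y"
| "binop_val Mul x y = x * y"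
| "binop_val Quot x y = x div y"
| "binop_val Rem x y = x mod y"
| "binop_val BAnd x y = and x y"
| "binop_val BOr x y = or x y"
| "binop_val BXor x y = xor x y"
| "binop_val Shl x y = push_bit (nat y) x"
| "binop_val Shr x y = drop_bit (nat y) x"
| "binop_val Eq x y = (if x = y then 1 else 0)"
| "binop_val Lt x y = (if x < y then 1 else 0)"

text \<open>Registers are numbered; \<open>Load r s\<close> reads the cell whose address is in register \<open>s\<close>, and
  \<open>Store r s\<close> writes the content of \<open>s\<close> to the cell whose address is in register \<open>r\<close>.\<close>

datatype com =
    Skip
  | Const nat int
  | Op binop nat nat nat
  | Load nat nat
  | Store nat nat
  | Seq com com
  | If nat com com
  | While nat com

type_synonym state = "(nat \<Rightarrow> int) \<times> (nat \<Rightarrow> int)"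

definition is_word :: "nat \<Rightarrow> int \<Rightarrow> bool" where
  "is_word w x \<longleftrightarrow> - (2 ^ (w - 1)) \<le> x \<and> x < 2 ^ (w - 1)"

text \<open>\<open>exec w c s t s'\<close>: with \<open>w\<close>-bit words, the program \<open>c\<close> started in state \<open>s\<close> terminates after
  \<open>t\<close> steps in state \<open>s'\<close>. Every instruction and every test costs one step.\<close>

inductive exec :: "nat \<Rightarrow> com \<Rightarrow> state \<Rightarrow> nat \<Rightarrow> state \<Rightarrow> bool" for w :: nat where
  Skip: "exec w Skip s 1 s"
| Const: "is_word w k \<Longrightarrow> exec w (Const r k) (R, M) 1 (R(r := k), M)"
| Op: "is_word w (binop_val f (R p) (R q)) \<Longrightarrow>
    exec w (Op f r p q) (R, M) 1 (R(r := binop_val f (R p) (R q)), M)"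
| Load: "0 \<le> R s \<Longrightarrow> exec w (Load r s) (R, M) 1 (R(r := M (nat (R s))), M)"
| Store: "0 \<le> R r \<Longrightarrow> exec w (Store r s) (R, M) 1 (R, M(nat (R r) := R s))"
| Seq: "exec w c\<^sub>1 s\<^sub>1 t\<^sub>1 s\<^sub>2 \<Longrightarrow> exec w c\<^sub>2 s\<^sub>2 t\<^sub>2 s\<^sub>3 \<Longrightarrow> exec w (Seq c\<^sub>1 c\<^sub>2) s\<^sub>1 (t\<^sub>1 + t\<^sub>2) s\<^sub>3"
| IfTrue: "fst s r \<noteq> 0 \<Longrightarrow> exec w c\<^sub>1 s t s' \<Longrightarrow> exec w (If r c\<^sub>1 c\<^sub>2) s (1 + t) s'"
| IfFalse: "fst s r = 0 \<Longrightarrow> exec w c\<^sub>2 s t s' \<Longrightarrow> exec w (If r c\<^sub>1 c\<^sub>2) s (1 + t) s'"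
| WhileFalse: "fst s r = 0 \<Longrightarrow> exec w (While r c) s 1 s"
| WhileTrue: "fst s\<^sub>1 r \<noteq> 0 \<Longrightarrow> exec w c s\<^sub>1 t\<^sub>1 s\<^sub>2 \<Longrightarrow> exec w (While r c) s\<^sub>2 t\<^sub>2 s\<^sub>3 \<Longrightarrow>
    exec w (While r c) s\<^sub>1 (1 + t\<^sub>1 + t\<^sub>2) s\<^sub>3"

text \<open>The input occupies the first memory cells, everything else is initially zero. On termination
  the output is found in the first memory cells.\<close>

definition init_state :: "int list \<Rightarrow> state" where
  "init_state xs = ((\<lambda>_. 0), (\<lambda>i. if i < length xs then xs ! i else 0))"

definition computes :: "nat \<Rightarrow> com \<Rightarrow> int list \<Rightarrow> nat \<Rightarrow> int list \<Rightarrow> bool" where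
  "computes w c xs t ys \<longleftrightarrow>
     (\<forall>x \<in> set xs. is_word w x) \<and>
     (\<exists>R M. exec w c (init_state xs) t (R, M) \<and> (\<forall>i < length ys. M i = ys ! i))"

definition word_size :: "nat \<Rightarrow> nat \<Rightarrow> nat" where
  "word_size \<kappa> n = \<kappa> * nat \<lceil>log 2 (real n + 2)\<rceil>"

text \<open>A problem gives for every size parameter \<open>n\<close> the input/output pairs of its instances. It is
  solvable in time \<open>T\<close> if a single program solves all instances of every size \<open>n\<close> within \<open>T n\<close> steps
  on words of \<open>O(log n)\<close> bits.\<close>

type_synonym problem = "nat \<Rightarrow> (int list \<times> int list) set"

definition solvable_in_time :: "problem \<Rightarrow> (nat \<Rightarrow> real) \<Rightarrow> bool" where
  "solvable_in_time \<Pi> T \<longleftrightarrow>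
     (\<exists>\<kappa> c. \<forall>n > 0. \<forall>(xs, ys) \<in> \<Pi> n.
        \<exists>t. computes (word_size \<kappa> n) c xs t ys \<and> real t \<le> T n)"


section \<open>The problems\<close>

definition mono_conv :: "int list \<Rightarrow> int list \<Rightarrow> int list \<Rightarrow> int list" where
  "mono_conv a b c =
     map (\<lambda>i. if \<exists>j \<le> i. a ! j = b ! (i - j) \<and> b ! (i - j) = c ! i then 1 else 0) [0..<length c]"

text \<open>Entries must fit into words of \<open>O(log n)\<close> bits, so they are bounded by \<open>n ^ \<gamma>\<close> for a
  constant \<open>\<gamma>\<close>.\<close>

definition MonoConvolution :: "nat \<Rightarrow> problem" where
  "MonoConvolution \<gamma> n =
     {(int n # a @ b @ c, mono_conv a b c) | a b c.
        length a = n \<and> length b = n \<and> length c = n \<and>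
        (\<forall>x \<in> set a \<union> set b \<union> set c. \<bar>x\<bar> \<le> int n ^ \<gamma>)}"

definition min_coins :: "nat set \<Rightarrow> nat \<Rightarrow> enat" where
  "min_coins C v = (INF K \<in> {K. set_mset K \<subseteq> C \<and> sum_mset K = v}. enat (size K))"

text \<open>The value \<open>\<infinity>\<close> is output as \<open>-1\<close>.\<close>

fun enat_code :: "enat \<Rightarrow> int" where
  "enat_code (enat k) = int k"
| "enat_code \<infinity> = -1"

text \<open>The coin set is input as a list of its elements, in arbitrary order, preceded by its
  cardinality.\<close>

definition CoinChange :: problem where
  "CoinChange n =
     {(int n # int (length cs) # map int cs,
       map (\<lambda>v. enat_code (min_coins (set cs) v)) [1..<Suc n]) | cs.
        distinct cs \<and> set cs \<subseteq> {1..n}}"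

end

theory Submission
  imports Defs
begin

text \<open>
  Let \<open>opt v\<close> be the minimum number of coins for \<open>v\<close>. The program doubles a bound \<open>S\<close> up to which all
  values of \<open>opt\<close> are known. If \<open>opt v = k \<le> 2 * S\<close>, then an optimal multiset for \<open>v\<close> splits into optimal
  multisets of sizes \<open>p = k div 2\<close> and \<open>q = k - p\<close>, so that \<open>q\<close> is \<open>p\<close> or \<open>p + 1\<close>, and \<open>p, q \<le> S\<close>. For all
  \<open>v\<close> in parallel, \<open>p - 1\<close> is determined by binary search: a candidate interval \<open>{U v..<U v + G}\<close>, with \<open>G\<close>
  dividing \<open>U v\<close>, is tested with two monochromatic convolutions, of the labels
  \<open>(opt j - 1) div G\<close>, \<open>(opt j' - 1 - \<delta>) div G\<close> and \<open>U v div G\<close> for \<open>\<delta> = 0, 1\<close>; equal labels force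
  \<open>opt v \<le> opt j + opt j' \<le> 2 * (U v + G) + \<delta>\<close>. In the end \<open>G = 1\<close> and \<open>\<delta>\<close> is the parity of \<open>opt v\<close>. This
  makes \<open>O(log n)\<close> calls for each of the \<open>O(log n)\<close> values of \<open>S\<close>, all on sequences of length exactly \<open>n\<close>,
  because \<open>T\<close> need not be monotone. Linear work per call is affordable since \<open>T n \<ge> n\<close>: the \<open>n\<close> output
  bits may all have to overwrite input cells.

  A word RAM cannot clear the memory used by an arbitrary subroutine at a bounded cost. Therefore
  memory is viewed as a matrix with sufficiently many columns, and every call works in a fresh one.
\<close>

section \<open>Optimal payments\<close>

definition payable :: "nat set \<Rightarrow> nat \<Rightarrow> nat \<Rightarrow> bool" where
  "payable C v k \<longleftrightarrow> (\<exists>K. set_mset K \<subseteq> C \<and> sum_mset K = v \<and> size K = k)"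

text \<open>A relation instead of a function, so that values that cannot be paid need no
  default.\<close>

definition optimal :: "nat set \<Rightarrow> nat \<Rightarrow> nat \<Rightarrow> bool" where
  "optimal C v k \<longleftrightarrow> payable C v k \<and> (\<forall>k'. payable C v k' \<longrightarrow> k \<le> k')"

lemma payable_add:
  assumes "payable C v k" "payable C v' k'"
  shows "payable C (v + v') (k + k')"
proof -
  from assms obtain K K' where "set_mset K \<subseteq> C" "sum_mset K = v" "size K = k"
    "set_mset K' \<subseteq> C" "sum_mset K' = v'" "size K' = k'"
    unfolding payable_def by blast
  then show ?thesis unfolding payable_def by (intro exI[of _ "K + K'"]) auto
qed

text \<open>Each coin is worth at least 1. This limits the doubling, the labels and the sizes of the
  words.\<close>

lemma payable_le:
  assumes "payable C v k" "0 \<notin> C"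
  shows "k \<le> v"
proof -
  have "size K \<le> sum_mset K" if "0 \<notin># K" for K :: "nat multiset"
    using that by (induction K) auto
  with assms show ?thesis unfolding payable_def by blast
qed

lemma payable_optimal: "payable C v k \<Longrightarrow> \<exists>k'. optimal C v k' \<and> k' \<le> k"
  unfolding optimal_def by (metis LeastI Least_le)

lemma optimal_unique: "optimal C v k \<Longrightarrow> optimal C v k' \<Longrightarrow> k = k'"
  unfolding optimal_def by (simp add: le_antisym)

lemma payable_0: "payable C 0 0"
  unfolding payable_def by (intro exI[of _ "{#}"]) auto

lemma optimal_0: "optimal C 0 k \<Longrightarrow> k = 0"
  unfolding optimal_def using payable_0 by blast

lemma optimal_positive: "optimal C v k \<Longrightarrow> 0 < v \<Longrightarrow> 0 < k"
  unfolding optimal_def payable_def by (auto intro!: gr0I)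

lemma optimal_one_iff:
  assumes "0 \<notin> C"
  shows "optimal C v 1 \<longleftrightarrow> v \<in> C"
proof
  assume "optimal C v 1"
  then obtain K where K: "set_mset K \<subseteq> C" "sum_mset K = v" "size K = 1"
    unfolding optimal_def payable_def by blast
  from K(3) obtain c where "K = {#c#}" using size_1_singleton_mset by blast
  with K show "v \<in> C" by auto
next
  assume v: "v \<in> C"
  then have "payable C v 1"
    unfolding payable_def by (intro exI[of _ "{#v#}"]) auto
  moreover have "v \<noteq> 0" using v assms by metis
  then have "k \<noteq> 0" if "payable C v k" for k
    using that unfolding payable_def by (metis size_eq_0_iff_empty sum_mset.empty)
  ultimately show "optimal C v 1"
    unfolding optimal_def by (metis One_nat_def Suc_leI gr0I)
qed

text \<open>Cut an optimal multiset, listed in some order, after \<open>p\<close> coins: if one part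
  could be paid with fewer coins, \<open>payable_add\<close> would make the whole cheaper
  too.\<close>

lemma optimal_split:
  assumes "optimal C v (p + q)"
  obtains j j' where "v = j + j'" "optimal C j p" "optimal C j' q"
proof -
  from assms obtain K where K: "set_mset K \<subseteq> C" "sum_mset K = v" "size K = p + q"
    unfolding optimal_def payable_def by blast
  obtain xs where xs: "mset xs = K" using ex_mset by blast
  define K1 K2 where "K1 = mset (take p xs)" and "K2 = mset (drop p xs)"
  have "K = K1 + K2" using xs by (simp add: K1_def K2_def flip: mset_append)
  moreover have "length xs = p + q" using K xs by auto
  then have "size K1 = p" "size K2 = q" by (auto simp: K1_def K2_def)
  ultimately have pay: "payable C (sum_mset K1) p" "payable C (sum_mset K2) q"
    and v: "v = sum_mset K1 + sum_mset K2"
    using K unfolding payable_def by auto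
  have "optimal C (sum_mset K1) p"
    unfolding optimal_def
  proof (intro conjI allI impI)
    fix k assume "payable C (sum_mset K1) k"
    from payable_add[OF this pay(2)] assms show "p \<le> k" unfolding v optimal_def by fastforce
  qed (fact pay)
  moreover have "optimal C (sum_mset K2) q"
    unfolding optimal_def
  proof (intro conjI allI impI)
    fix k assume "payable C (sum_mset K2) k"
    from payable_add[OF pay(1) this] assms show "q \<le> k" unfolding v optimal_def by fastforce
  qed (fact pay)
  ultimately show thesis using that v by blast
qed

lemma min_coins_optimal:
  assumes "optimal C v k"
  shows "min_coins C v = enat k"
  unfolding min_coins_def
proof (rule antisym)
  show "(INF K\<in>{K. set_mset K \<subseteq> C \<and> sum_mset K = v}. enat (size K)) \<le> enat k"
    using assms unfolding optimal_def payable_def by (auto intro: INF_lower2)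
  show "enat k \<le> (INF K\<in>{K. set_mset K \<subseteq> C \<and> sum_mset K = v}. enat (size K))"
    using assms unfolding optimal_def by (intro INF_greatest) (auto simp: payable_def)
qed

lemma min_coins_unpayable: "\<forall>k. \<not> payable C v k \<Longrightarrow> min_coins C v = \<infinity>"
proof -
  assume "\<forall>k. \<not> payable C v k"
  then have "{K. set_mset K \<subseteq> C \<and> sum_mset K = v} = {}" unfolding payable_def by blast
  then show ?thesis unfolding min_coins_def by (simp add: top_enat_def del: Collect_empty_eq)
qed

section \<open>Outcome of a convolution and the invariants of the search\<close>

definition hit :: "nat \<Rightarrow> (nat \<Rightarrow> int) \<Rightarrow> (nat \<Rightarrow> int) \<Rightarrow> int \<Rightarrow> int \<Rightarrow> nat \<Rightarrow> bool" where
  "hit n F U H \<delta> v \<longleftrightarrow> (\<exists>j j'. j \<in> {1..n} \<and> j' \<in> {1..n} \<and> v = j + j' \<and>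
     (F j - 1) div H = U v div H \<and> (F j' - 1 - \<delta>) div H = U v div H)"

text \<open>The value \<open>0\<close> marks numbers of coins that are not known yet.\<close>

definition known :: "nat \<Rightarrow> nat set \<Rightarrow> int \<Rightarrow> (nat \<Rightarrow> int) \<Rightarrow> bool" where
  "known n C S F \<longleftrightarrow> (\<forall>v \<in> {1..n + 1}. (F v = 0 \<or> (\<exists>k. F v = int k \<and> optimal C v k)) \<and>
     (\<forall>k. int k \<le> S \<and> optimal C v k \<longrightarrow> F v = int k))"

text \<open>The conclusion says \<open>U v \<le> k div 2 - 1 < U v + H\<close>.\<close>

definition search :: "nat \<Rightarrow> nat set \<Rightarrow> int \<Rightarrow> int \<Rightarrow> (nat \<Rightarrow> int) \<Rightarrow> bool" where
  "search n C S H U \<longleftrightarrow> (\<forall>v \<in> {2..n + 1}. 0 \<le> U v \<and> H dvd U v \<and> U v + H \<le> S \<and>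
     (\<forall>k \<ge> 2. int k \<le> 2 * S \<and> optimal C v k \<longrightarrow> 2 * U v + 2 \<le> int k \<and> int k \<le> 2 * (U v + H) + 1))"

text \<open>A multiple of \<open>H\<close> is the least element of its quotient class, so comparing
  labels amounts to testing membership in an interval of length \<open>H\<close> that starts
  there.\<close>

lemma div_eq_dvd_iff:
  fixes x u H :: int
  assumes "H \<ge> 1" "H dvd u"
  shows "x div H = u div H \<longleftrightarrow> u \<le> x \<and> x < u + H"
proof -
  obtain m where u: "u = H * m" using assms(2) by blast
  have "x div H = m \<longleftrightarrow> H * m \<le> x \<and> x < H * m + H"
  proof
    assume "x div H = m"
    then have "x = H * m + x mod H" using mult_div_mod_eq[of H x] by simp
    with assms(1) show "H * m \<le> x \<and> x < H * m + H"
      using pos_mod_bound[of H x] pos_mod_sign[of H x] by linarith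
  next
    assume "H * m \<le> x \<and> x < H * m + H"
    then show "x div H = m"
      using int_div_pos_eq[of x H m "x - H * m"] by linarith
  qed
  then show ?thesis using u assms(1) by simp
qed

text \<open>The labels give \<open>F j \<le> U v + H\<close> and
  \<open>F j' \<le> U v + H + \<delta>\<close>. Only an upper bound on the optimum follows, because
  the pair found need not come from an optimal split.\<close>

lemma hit_sound:
  assumes "known n C S F" "hit n F U H \<delta> v" "H \<ge> 1" "H dvd U v" "0 \<le> U v" "0 \<le> \<delta>"
  shows "\<exists>k. optimal C v k \<and> int k \<le> 2 * (U v + H) + \<delta>"
proof -
  obtain j j' where j: "j \<in> {1..n}" "j' \<in> {1..n}" "v = j + j'"
    "(F j - 1) div H = U v div H" "(F j' - 1 - \<delta>) div H = U v div H"
    using assms(2) unfolding hit_def by blast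
  then have bounds: "U v \<le> F j - 1" "F j - 1 < U v + H" "U v \<le> F j' - 1 - \<delta>" "F j' - 1 - \<delta> < U v + H"
    using assms(3,4) by (simp_all add: div_eq_dvd_iff)
  \<comment> \<open>The marker \<open>0\<close> would make \<open>F j - 1\<close> or
    \<open>F j' - 1 - \<delta>\<close> negative, hence smaller than \<open>U v\<close>; unknown
    values therefore never cause a hit.\<close>
  then have "F j \<noteq> 0" "F j' \<noteq> 0" using assms(5,6) by auto
  moreover have "j \<in> {1..n + 1}" "j' \<in> {1..n + 1}" using j by auto
  ultimately obtain p q where pq: "F j = int p" "optimal C j p" "F j' = int q" "optimal C j' q"
    using assms(1) unfolding known_def by blast
  then have "payable C v (p + q)" using payable_add j(3) unfolding optimal_def by blast
  from payable_optimal[OF this] obtain k where "optimal C v k" "k \<le> p + q" by blast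
  moreover from this(2) have "int k \<le> int p + int q" by linarith
  then have "int k \<le> 2 * (U v + H) + \<delta>" using bounds pq(1,3) by presburger
  ultimately show ?thesis by blast
qed

text \<open>Subtracting the parity of \<open>k\<close> from the larger half makes both numerators
  equal to \<open>k div 2 - 1\<close>, which the last two hypotheses place in the interval. Both
  halves are at most \<open>S\<close>, hence known.\<close>

lemma hit_complete:
  assumes "known n C S F" "optimal C v k" "2 \<le> k" "int k \<le> 2 * S" "v \<le> n + 1" "H \<ge> 1" "H dvd U v"
    "2 * U v + 2 \<le> int k" "int k \<le> 2 * (U v + H) + 1"
  shows "hit n F U H (int (k mod 2)) v"
proof -
  define p q where "p = k div 2" and "q = k div 2 + k mod 2"
  have k: "k = p + q" unfolding p_def q_def by presburger
  obtain j j' where j: "v = j + j'" "optimal C j p" "optimal C j' q"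
    using optimal_split assms(2) k by metis
  have pos: "p \<ge> 1" "q \<ge> 1" and "int p \<le> S" "int q \<le> S"
    using assms(3,4) unfolding p_def q_def by presburger+
  then have "j \<noteq> 0" "j' \<noteq> 0" using j(2,3) optimal_0[of C p] optimal_0[of C q] by (metis not_one_le_zero)+
  then have jn: "j \<in> {1..n}" "j' \<in> {1..n}" using assms(5) j(1) by auto
  then have "F j = int p" "F j' = int q"
    using assms(1) j \<open>int p \<le> S\<close> \<open>int q \<le> S\<close> unfolding known_def by auto
  moreover have "U v \<le> int p - 1" "int p - 1 < U v + H"
    using assms(8,9) by (auto simp: p_def)
  moreover have "int q - int (k mod 2) = int p" by (simp add: p_def q_def)
  then have "int q - 1 - int (k mod 2) = int p - 1" by linarith
  ultimately show ?thesis
    unfolding hit_def using j(1) jn assms(6,7)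
    by (intro exI[of _ j] exI[of _ j']) (simp add: div_eq_dvd_iff)
qed

text \<open>A hit bounds the optimum by \<open>2 * (U v + G) + 1\<close>, so the lower half is kept.
  If neither parity gives a hit, then in particular the parity of the optimum gives none, and by
  completeness the optimum lies beyond the lower half.\<close>

lemma search_step:
  assumes kn: "known n C S F" and se: "search n C S (2 * G) U" and G: "G \<ge> 1"
    and U': "\<And>v. v \<in> {2..n + 1} \<Longrightarrow>
      U' v = (if hit n F U G 0 v \<or> hit n F U G 1 v then U v else U v + G)"
  shows "search n C S G U'"
  unfolding search_def
proof (intro ballI)
  fix v assume v: "v \<in> {2..n + 1}"
  have U: "0 \<le> U v" "2 * G dvd U v" "U v + 2 * G \<le> S"
    "\<And>k. k \<ge> 2 \<Longrightarrow> int k \<le> 2 * S \<Longrightarrow> optimal C v k \<Longrightarrow>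
      2 * U v + 2 \<le> int k \<and> int k \<le> 2 * (U v + 2 * G) + 1"
    using se v unfolding search_def by auto
  have dvd: "G dvd U v" using U(2) by (metis dvd_mult_right)
  have "2 * U' v + 2 \<le> int k \<and> int k \<le> 2 * (U' v + G) + 1"
    if k: "k \<ge> 2" "int k \<le> 2 * S" "optimal C v k" for k
  proof (cases "hit n F U G 0 v \<or> hit n F U G 1 v")
    case True
    then obtain \<delta> :: int where "hit n F U G \<delta> v" "0 \<le> \<delta>" "\<delta> \<le> 1"
      by (metis order_refl zero_le_one)
    then obtain k' where "optimal C v k'" "int k' \<le> 2 * (U v + G) + \<delta>"
      using hit_sound[where U = U and v = v, OF kn _ G dvd U(1)] by blast
    with k \<open>\<delta> \<le> 1\<close> have "int k \<le> 2 * (U v + G) + 1" using optimal_unique[of C v k k'] by simp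
    with True U(4)[OF k] U'[OF v] show ?thesis by simp
  next
    case False
    have "int (k mod 2) = 0 \<or> int (k mod 2) = 1" by auto
    with False have "\<not> hit n F U G (int (k mod 2)) v" by metis
    then have "\<not> int k \<le> 2 * (U v + G) + 1"
      using hit_complete[where U = U and v = v, OF kn k(3,1,2) _ G dvd] U(4)[OF k] v by auto
    with False U(4)[OF k] U'[OF v] show ?thesis by simp
  qed
  moreover have "0 \<le> U' v \<and> G dvd U' v \<and> U' v + G \<le> S"
    using U'[OF v] U(1-3) dvd G by simp
  ultimately show "0 \<le> U' v \<and> G dvd U' v \<and> U' v + G \<le> S \<and> (\<forall>k \<ge> 2. int k \<le> 2 * S \<and>
      optimal C v k \<longrightarrow> 2 * U' v + 2 \<le> int k \<and> int k \<le> 2 * (U' v + G) + 1)"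
    by blast
qed

text \<open>With intervals of length 1, only \<open>2 * U v + 2\<close> and
  \<open>2 * U v + 3\<close> remain for optima from 2 to \<open>2 * S\<close>. Parity
  \<open>0\<close> has to be tested first: a hit for parity \<open>1\<close> only yields the upper
  bound \<open>2 * U v + 3\<close>, which both candidates satisfy.\<close>

lemma known_double:
  assumes kn: "known n C S F" and se: "search n C S 1 U" and S: "S \<ge> 1" and C: "0 \<notin> C"
    and F1: "F' 1 = F 1"
    and F': "\<And>v. v \<in> {2..n + 1} \<Longrightarrow> F' v = (if F v \<noteq> 0 then F v
      else if hit n F U 1 0 v then 2 * U v + 2 else if hit n F U 1 1 v then 2 * U v + 3 else 0)"
  shows "known n C (2 * S) F'"
  unfolding known_def
proof (intro ballI)
  fix v assume v: "v \<in> {1..n + 1}"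
  have F: "F v = 0 \<or> (\<exists>k. F v = int k \<and> optimal C v k)"
    "\<And>k. int k \<le> S \<Longrightarrow> optimal C v k \<Longrightarrow> F v = int k"
    using kn v unfolding known_def by auto
  consider "v = 1" | "F v \<noteq> 0" "v \<noteq> 1" | "F v = 0" "v \<in> {2..n + 1}" using v by fastforce
  then show "(F' v = 0 \<or> (\<exists>k. F' v = int k \<and> optimal C v k)) \<and>
    (\<forall>k. int k \<le> 2 * S \<and> optimal C v k \<longrightarrow> F' v = int k)"
  proof cases
    \<comment> \<open>The value 1 is no sum of two positive values. Its optimum is at most 1, within
      \<open>S\<close>, so its entry is final already.\<close>
    case 1
    moreover have "int k \<le> S" if "optimal C v k" for k
      using that payable_le[of C v k] C S 1 unfolding optimal_def by auto
    ultimately show ?thesis using F F1 by auto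
  next
    case 2
    then have "F' v = F v" using F' v by simp
    moreover obtain k where "F v = int k" "optimal C v k" using F(1) 2 by blast
    ultimately show ?thesis using optimal_unique by metis
  next
    case 3
    have U: "0 \<le> U v" "U v + 1 \<le> S"
      "\<And>k. k \<ge> 2 \<Longrightarrow> int k \<le> 2 * S \<Longrightarrow> optimal C v k \<Longrightarrow> 2 * U v + 2 \<le> int k \<and> int k \<le> 2 * (U v + 1) + 1"
      using se 3 unfolding search_def by auto
    \<comment> \<open>An unknown optimum exceeds \<open>S \<ge> 1\<close>, so it is at least 2 and
      falls under the search invariant if it is at most \<open>2 * S\<close>.\<close>
    have large: "k \<ge> 2 \<and> int k > S" if "optimal C v k" for k
    proof -
      have "k \<noteq> 0" using optimal_positive[OF that] v by simp
      moreover have "\<not> int k \<le> S" using F(2)[of k] that 3 \<open>k \<noteq> 0\<close> by auto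
      ultimately show ?thesis using S by linarith
    qed
    have complete: "hit n F U 1 (int (k mod 2)) v" if "optimal C v k" "int k \<le> 2 * S" for k
      using hit_complete[where U = U and v = v, OF kn that(1) _ that(2)] large[OF that(1)] U(3)[OF _ that(2,1)] 3 by auto
    consider "hit n F U 1 0 v" | "\<not> hit n F U 1 0 v" "hit n F U 1 1 v"
      | "\<not> hit n F U 1 0 v" "\<not> hit n F U 1 1 v" by blast
    then show ?thesis
    proof cases
      case 1
      then obtain k where k: "optimal C v k" "int k \<le> 2 * (U v + 1) + 0"
        using hit_sound[where U = U and v = v, OF kn 1] U by auto
      have "int k \<le> 2 * S" using k(2) U(2) by simp
      then have "int k = 2 * U v + 2"
        using U(3)[OF _ _ k(1)] large[OF k(1)] k(2) by simp
      moreover have "F' v = 2 * U v + 2" using F' 3 1 by simp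
      ultimately show ?thesis using k(1) optimal_unique by metis
    next
      case 2
      then obtain k where k: "optimal C v k" "int k \<le> 2 * (U v + 1) + 1"
        using hit_sound[where U = U and v = v, OF kn 2(2)] U by auto
      \<comment> \<open>Up to \<open>2 * S\<close>, the even candidate would have caused a hit for
        parity \<open>0\<close>. Beyond it, \<open>U v + 1 \<le> S\<close> gives
        \<open>2 * U v + 3 \<le> 2 * S + 1 \<le> k\<close>, which meets the upper bound.\<close>
      have "int k = 2 * U v + 3"
      proof (cases "int k \<le> 2 * S")
        case True
        with complete[OF k(1)] have "hit n F U 1 (int (k mod 2)) v" by blast
        with 2(1) have "k mod 2 \<noteq> 0" by (intro notI) simp
        then have "int k \<noteq> 2 * U v + 2" by presburger
        then show ?thesis using U(3)[OF _ True k(1)] large[OF k(1)] by simp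
      qed (use U(2) k(2) in simp)
      moreover have "F' v = 2 * U v + 3" using F' 3 2 by simp
      ultimately show ?thesis using k(1) optimal_unique by metis
    next
      case no_hit: 3
      have "int (k mod 2) = 0 \<or> int (k mod 2) = 1" for k by auto
      then have "\<not> int k \<le> 2 * S" if "optimal C v k" for k
        using complete[OF that] no_hit by metis
      moreover have "F' v = 0" using F' 3 no_hit by simp
      ultimately show ?thesis by blast
    qed
  qed
qed

text \<open>\<open>0\<close> is a multiple of every length, and the interval of length
  \<open>S\<close> from \<open>0\<close> contains \<open>k div 2 - 1\<close> for every
  \<open>k\<close> from 2 to \<open>2 * S\<close>.\<close>

lemma search_init: "S \<ge> 1 \<Longrightarrow> (\<And>v. U v = 0) \<Longrightarrow> search n C S S U"
  unfolding search_def by auto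

lemma known_init:
  assumes "0 \<notin> C" "\<And>v. v \<in> {1..n + 1} \<Longrightarrow> F v = (if v \<in> C then 1 else 0)"
  shows "known n C 1 F"
  unfolding known_def
proof (intro ballI)
  fix v assume v: "v \<in> {1..n + 1}"
  have "k = 1" if "int k \<le> 1" "optimal C v k" for k
  proof -
    have "k \<noteq> 0" using optimal_positive[OF that(2)] v by simp
    with that show ?thesis by simp
  qed
  moreover have "optimal C v 1 \<longleftrightarrow> v \<in> C" using optimal_one_iff[OF assms(1)] .
  ultimately show "(F v = 0 \<or> (\<exists>k. F v = int k \<and> optimal C v k)) \<and>
      (\<forall>k. int k \<le> 1 \<and> optimal C v k \<longrightarrow> F v = int k)"
    using assms(2)[OF v] by (cases "v \<in> C") (auto intro!: exI[of _ 1])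
qed

text \<open>An optimum for \<open>v \<le> n\<close> uses at most \<open>n\<close> coins and has been
  found. It is positive since \<open>v\<close> is, so the entry \<open>0\<close> can only mean that
  \<open>v\<close> cannot be paid.\<close>

lemma known_final:
  assumes "known n C S F" "int n \<le> S" "0 \<notin> C" "v \<in> {1..n}"
  shows "enat_code (min_coins C v) = (if F v = 0 then - 1 else F v)"
proof (cases "\<exists>k. payable C v k")
  case True
  then obtain k where k: "optimal C v k" using payable_optimal by blast
  then have "int k \<le> S" using payable_le[of C v k] assms unfolding optimal_def by auto
  with k assms have "F v = int k" unfolding known_def by auto
  moreover have "k \<noteq> 0" using optimal_positive[OF k] assms(4) by simp
  ultimately show ?thesis using min_coins_optimal[OF k] by simp
next
  case False
  moreover have "v \<in> {1..n + 1}" using assms(4) by simp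
  ultimately have "F v = 0" using assms(1) unfolding known_def optimal_def by blast
  then show ?thesis using False min_coins_unpayable[of C v] by simp
qed

lemma known_bounds:
  assumes "known n C S F" "0 \<notin> C" "v \<in> {1..n + 1}"
  shows "0 \<le> F v" "F v \<le> int v"
proof -
  have "F v = 0 \<or> (\<exists>k. F v = int k \<and> optimal C v k)"
    using assms(1,3) unfolding known_def by blast
  then show "0 \<le> F v" "F v \<le> int v"
    using payable_le[OF _ assms(2)] unfolding optimal_def by auto
qed

section \<open>Reasoning about word RAM programs\<close>

definition wp :: "nat \<Rightarrow> com \<Rightarrow> (nat \<Rightarrow> state \<Rightarrow> bool) \<Rightarrow> state \<Rightarrow> bool" where
  "wp w c Q s \<longleftrightarrow> (\<exists>t s'. exec w c s t s' \<and> Q t s')"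

inductive_cases exec_SkipE: "exec w Skip s t s'"
inductive_cases exec_ConstE: "exec w (Const r k) s t s'"
inductive_cases exec_OpE: "exec w (Op f r p q) s t s'"
inductive_cases exec_LoadE: "exec w (Load r p) s t s'"
inductive_cases exec_StoreE: "exec w (Store r p) s t s'"
inductive_cases exec_SeqE: "exec w (Seq c1 c2) s t s'"
inductive_cases exec_IfE: "exec w (If r c1 c2) s t s'"

lemma wpI: "exec w c s t s' \<Longrightarrow> Q t s' \<Longrightarrow> wp w c Q s"
  unfolding wp_def by blast

lemma wp_mono: "wp w c Q s \<Longrightarrow> (\<And>t s'. Q t s' \<Longrightarrow> Q' t s') \<Longrightarrow> wp w c Q' s"
  unfolding wp_def by blast

lemma wp_Skip [simp]: "wp w Skip Q s \<longleftrightarrow> Q 1 s"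
  by (rule iffI, (auto simp: wp_def elim: exec_SkipE)[1], rule wpI[OF exec.Skip], auto)

lemma wp_Const [simp]: "wp w (Const r k) Q (R, M) \<longleftrightarrow> is_word w k \<and> Q 1 (R(r := k), M)"
  by (rule iffI, (auto simp: wp_def elim: exec_ConstE)[1], rule wpI[OF exec.Const], auto)

lemma wp_Op [simp]: "wp w (Op f r p q) Q (R, M) \<longleftrightarrow>
  is_word w (binop_val f (R p) (R q)) \<and> Q 1 (R(r := binop_val f (R p) (R q)), M)"
  by (rule iffI, (auto simp: wp_def elim: exec_OpE)[1], rule wpI[OF exec.Op], auto)

lemma wp_Load [simp]: "wp w (Load r p) Q (R, M) \<longleftrightarrow> 0 \<le> R p \<and> Q 1 (R(r := M (nat (R p))), M)"
  by (rule iffI, (auto simp: wp_def elim: exec_LoadE)[1], rule wpI[OF exec.Load], auto)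

lemma wp_Store [simp]: "wp w (Store r p) Q (R, M) \<longleftrightarrow> 0 \<le> R r \<and> Q 1 (R, M(nat (R r) := R p))"
  by (rule iffI, (auto simp: wp_def elim: exec_StoreE)[1], rule wpI[OF exec.Store], auto)

lemma wp_Seq [simp]:
  "wp w (Seq c1 c2) Q s \<longleftrightarrow> wp w c1 (\<lambda>t1 s1. wp w c2 (\<lambda>t2 s2. Q (t1 + t2) s2) s1) s"
  unfolding wp_def by (fast elim: exec_SeqE intro: exec.Seq)

lemma wp_If [simp]: "wp w (If r c1 c2) Q s \<longleftrightarrow>
  (if fst s r \<noteq> 0 then wp w c1 (\<lambda>t. Q (1 + t)) s else wp w c2 (\<lambda>t. Q (1 + t)) s)"
proof
  assume "wp w (If r c1 c2) Q s"
  then show "if fst s r \<noteq> 0 then wp w c1 (\<lambda>t. Q (1 + t)) s else wp w c2 (\<lambda>t. Q (1 + t)) s"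
    unfolding wp_def by (clarify, elim exec_IfE) auto
next
  assume *: "if fst s r \<noteq> 0 then wp w c1 (\<lambda>t. Q (1 + t)) s else wp w c2 (\<lambda>t. Q (1 + t)) s"
  show "wp w (If r c1 c2) Q s"
  proof (cases "fst s r = 0")
    case True
    with * have "wp w c2 (\<lambda>t. Q (1 + t)) s" by argo
    with True show ?thesis unfolding wp_def by (fast intro: exec.IfFalse)
  next
    case False
    with * have "wp w c1 (\<lambda>t. Q (1 + t)) s" by argo
    with False show ?thesis unfolding wp_def by (fast intro: exec.IfTrue)
  qed
qed

text \<open>The index of the invariant is the number of iterations left, which gives termination.
  Each iteration costs its body and one test; the final \<open>1\<close> is the failing
  test.\<close>

lemma wp_While:
  assumes "I N s"
    and step: "\<And>x s. x < N \<Longrightarrow> I (Suc x) s \<Longrightarrow> fst s r \<noteq> 0 \<and> wp w c (\<lambda>t s'. t \<le> B \<and> I x s') s"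
    and stop: "\<And>s. I 0 s \<Longrightarrow> fst s r = 0"
  shows "wp w (While r c) (\<lambda>t s'. t \<le> N * (B + 1) + 1 \<and> I 0 s') s"
  using assms(1) step
proof (induction N arbitrary: s)
  case 0
  then show ?case
    using stop by (intro wpI[OF exec.WhileFalse]) auto
next
  case (Suc N)
  then obtain t1 s1 where 1: "fst s r \<noteq> 0" "exec w c s t1 s1" "t1 \<le> B" "I N s1"
    unfolding wp_def by blast
  have "wp w (While r c) (\<lambda>t s'. t \<le> N * (B + 1) + 1 \<and> I 0 s') s1"
    by (rule Suc.IH[OF 1(4)], rule Suc.prems(2)) auto
  then obtain t2 s2
    where 2: "exec w (While r c) s1 t2 s2" "t2 \<le> N * (B + 1) + 1" "I 0 s2"
    unfolding wp_def by blast
  show ?case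
    by (rule wpI[OF exec.WhileTrue[OF 1(1,2) 2(1)]]) (use 1(3) 2(2,3) in simp)
qed

text \<open>Register \<open>4\<close> has to contain \<open>1\<close>.\<close>

definition downto0 :: "nat \<Rightarrow> com \<Rightarrow> com" where
  "downto0 i c = While i (Seq (Op Sub i i 4) c)"

text \<open>The counter is decremented before the body runs, so the body handles the indices
  \<open>N - 1\<close> down to \<open>0\<close>, and \<open>I x\<close> can say that those from
  \<open>x\<close> on are done. Test and decrement account for the \<open>2\<close>.\<close>

lemma wp_downto0:
  assumes "R i = int N" "I N (R, M)" "is_word w (int N)"
    and one: "\<And>x R M. I x (R, M) \<Longrightarrow> R 4 = 1"
    and step: "\<And>x R M. x < N \<Longrightarrow> I (Suc x) (R, M) \<Longrightarrow>
      wp w c (\<lambda>t (R', M'). t \<le> B \<and> R' i = int x \<and> I x (R', M')) (R(i := int x), M)"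
  shows "wp w (downto0 i c) (\<lambda>t (R', M'). t \<le> N * (B + 2) + 1 \<and> I 0 (R', M')) (R, M)"
proof -
  let ?J = "\<lambda>x s. fst s i = int x \<and> I x s"
  have "wp w (While i (Seq (Op Sub i i 4) c)) (\<lambda>t s'. t \<le> N * (Suc B + 1) + 1 \<and> ?J 0 s') (R, M)"
  proof (rule wp_While)
    fix x and s :: state
    assume x: "x < N" and J: "?J (Suc x) s"
    obtain R M where s: "s = (R, M)" by fastforce
    have "is_word w (int x)"
      using assms(3) x by (auto simp: is_word_def intro: order_trans[of _ 0])
    moreover have "wp w c (\<lambda>t2 s'. Suc t2 \<le> Suc B \<and> ?J x s') (R(i := int x), M)"
      using step[OF x, of R M] J s by (auto elim!: wp_mono)
    ultimately show "fst s i \<noteq> 0 \<and> wp w (Seq (Op Sub i i 4) c) (\<lambda>t s'. t \<le> Suc B \<and> ?J x s') s"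
      using J s one[of "Suc x" R M] by simp
  qed (use assms in auto)
  then show ?thesis unfolding downto0_def by (auto elim!: wp_mono)
qed

section \<open>What a run can change, and a lower bound on its time\<close>

fun reg_bound :: "com \<Rightarrow> nat" where
  "reg_bound Skip = 0"
| "reg_bound (Const r k) = Suc r"
| "reg_bound (Op f r p q) = Suc r"
| "reg_bound (Load r p) = Suc r"
| "reg_bound (Store r p) = 0"
| "reg_bound (Seq c1 c2) = max (reg_bound c1) (reg_bound c2)"
| "reg_bound (If r c1 c2) = max (reg_bound c1) (reg_bound c2)"
| "reg_bound (While r c) = reg_bound c"

text \<open>Registers at or above the bound may be read but are never written. If they are
  \<open>0\<close> at first they stay so, and before a new call only the finitely many registers
  below the bound have to be reset.\<close>

lemma exec_unwritten_register: "exec w c s t s' \<Longrightarrow> reg_bound c \<le> r \<Longrightarrow> fst s' r = fst s r"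
  by (induction rule: exec.induct) auto

definition word_state :: "nat \<Rightarrow> state \<Rightarrow> bool" where
  "word_state w s \<longleftrightarrow> (\<forall>r. is_word w (fst s r)) \<and> (\<forall>i. is_word w (snd s i))"

lemma exec_word_state: "exec w c s t s' \<Longrightarrow> word_state w s \<Longrightarrow> word_state w s'"
  by (induction rule: exec.induct) (auto simp: word_state_def)

text \<open>A step writes at most one cell, and the changes of consecutive runs add up.\<close>

lemma exec_changed_cells: "exec w c s t s' \<Longrightarrow>
  finite {i. snd s' i \<noteq> snd s i} \<and> card {i. snd s' i \<noteq> snd s i} \<le> t"
proof (induction rule: exec.induct)
  case (Store R r p M)
  have "{i. (M(nat (R r) := R p)) i \<noteq> M i} \<subseteq> {nat (R r)}" by auto
  from finite_subset[OF this] card_mono[OF _ this] show ?case by simp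
next
  case (Seq c\<^sub>1 s\<^sub>1 t\<^sub>1 s\<^sub>2 c\<^sub>2 t\<^sub>2 s\<^sub>3)
  let ?D = "\<lambda>s s' :: state. {i. snd s' i \<noteq> snd s i}"
  have sub: "?D s\<^sub>1 s\<^sub>3 \<subseteq> ?D s\<^sub>1 s\<^sub>2 \<union> ?D s\<^sub>2 s\<^sub>3" by auto
  have "card (?D s\<^sub>1 s\<^sub>3) \<le> card (?D s\<^sub>1 s\<^sub>2) + card (?D s\<^sub>2 s\<^sub>3)"
    using card_mono[OF _ sub] card_Un_le[of "?D s\<^sub>1 s\<^sub>2" "?D s\<^sub>2 s\<^sub>3"] Seq.IH by fastforce
  with Seq.IH finite_subset[OF sub] show ?case by fastforce
next
  case (WhileTrue s\<^sub>1 r c t\<^sub>1 s\<^sub>2 t\<^sub>2 s\<^sub>3)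
  let ?D = "\<lambda>s s' :: state. {i. snd s' i \<noteq> snd s i}"
  have sub: "?D s\<^sub>1 s\<^sub>3 \<subseteq> ?D s\<^sub>1 s\<^sub>2 \<union> ?D s\<^sub>2 s\<^sub>3" by auto
  have "card (?D s\<^sub>1 s\<^sub>3) \<le> card (?D s\<^sub>1 s\<^sub>2) + card (?D s\<^sub>2 s\<^sub>3)"
    using card_mono[OF _ sub] card_Un_le[of "?D s\<^sub>1 s\<^sub>2" "?D s\<^sub>2 s\<^sub>3"] WhileTrue.IH by fastforce
  with WhileTrue.IH finite_subset[OF sub] show ?case by fastforce
qed auto

text \<open>The value 2 differs from both possible output bits, and cell 0 holds
  \<open>n \<ge> 2\<close>. All output bits are 1 here, so each of the first \<open>n\<close> cells
  has to be overwritten.\<close>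

lemma MonoConvolution_time_lower_bound:
  assumes "exec w c (init_state (int n # replicate n 2 @ replicate n 2 @ replicate n 2)) t (R, M)"
    and "n \<ge> 2"
    and out: "\<forall>i < n. M i = mono_conv (replicate n 2) (replicate n 2) (replicate n 2) ! i"
  shows "n \<le> t"
proof -
  define xs :: "int list" where "xs = int n # replicate n 2 @ replicate n 2 @ replicate n 2"
  have "{..<n} \<subseteq> {i. M i \<noteq> snd (init_state xs) i}"
  proof
    fix i assume i: "i \<in> {..<n}"
    then have "M i = 1" using out by (auto simp: mono_conv_def)
    then show "i \<in> {i. M i \<noteq> snd (init_state xs) i}"
      using i assms(2) by (cases i) (auto simp: init_state_def nth_append xs_def)
  qed
  from card_mono[OF _ this] have "card {..<n} \<le> t"
    using exec_changed_cells[OF assms(1)] by (simp add: xs_def)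
  then show ?thesis by simp
qed

section \<open>The program\<close>

fun block :: "com list \<Rightarrow> com" where
  "block [] = Skip"
| "block (c # cs) = Seq c (block cs)"

text \<open>
  The memory above \<open>base\<close> is a matrix with \<open>stride\<close> columns: entry \<open>i\<close> of column \<open>k\<close> is stored in cell
  \<open>base + i * stride + k\<close>. Columns are designated by registers that contain \<open>base + k\<close>. The following
  registers have a fixed meaning: 0 is scratch, 1 contains \<open>stride\<close>, 2 the column of the next call of
  the subroutine, 3 \<open>n\<close>, 4 the constant 1, 5 the constant 2, 6 the label width \<open>G\<close>, 7 and 8 the
  columns 0 and 1, 14 the bound \<open>S\<close>, 17 the parity \<open>\<delta>\<close>, 19 the constant 0, 20 and 21 the columns with
  the answers of the last two calls (for \<open>\<delta> = 1\<close> and \<open>\<delta> = 0\<close>). Registers from 32 on belong to the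
  subroutine.
\<close>

definition load_entry :: "nat \<Rightarrow> nat \<Rightarrow> nat \<Rightarrow> com" where
  "load_entry r i b = block [Op Mul 0 i 1, Op Add 0 0 b, Load r 0]"

definition store_entry :: "nat \<Rightarrow> nat \<Rightarrow> nat \<Rightarrow> com" where
  "store_entry i b r = block [Op Mul 0 i 1, Op Add 0 0 b, Store 0 r]"

text \<open>Register numbers move up by 32, out of the way of the caller, and an address becomes a
  row number in the column given by register 2.\<close>

fun embed_com :: "com \<Rightarrow> com" where
  "embed_com Skip = Skip"
| "embed_com (Const r k) = Const (r + 32) k"
| "embed_com (Op f r p q) = Op f (r + 32) (p + 32) (q + 32)"
| "embed_com (Load r p) = load_entry (r + 32) (p + 32) 2"
| "embed_com (Store r p) = store_entry (r + 32) 2 (p + 32)"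
| "embed_com (Seq c1 c2) = Seq (embed_com c1) (embed_com c2)"
| "embed_com (If r c1 c2) = If (r + 32) (embed_com c1) (embed_com c2)"
| "embed_com (While r c) = While (r + 32) (embed_com c)"

definition reset_registers :: "nat \<Rightarrow> com" where
  "reset_registers m = block (map (\<lambda>r. Const (r + 32) 0) [0..<m])"

text \<open>For counter value \<open>j\<close>, the cells \<open>j + 1\<close>,
  \<open>j + 1 + n\<close> and \<open>j + 1 + 2 * n\<close> of the new column are written, since
  cell 0 holds \<open>n\<close> and the three sequences follow it.\<close>

definition build_entry :: com where
  "build_entry = block
     [Op Add 10 9 4, load_entry 11 10 7, Op Sub 11 11 4, Op Quot 12 11 6, store_entry 10 2 12,
      Op Sub 11 11 17, Op Quot 12 11 6, Op Add 10 10 3, store_entry 10 2 12,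
      Op Add 13 9 5, load_entry 11 13 8, Op Quot 12 11 6, Op Add 10 10 3, store_entry 10 2 12]"

definition build_instance :: com where
  "build_instance = downto0 9 build_entry"

definition call_conv :: "com \<Rightarrow> int \<Rightarrow> com" where
  "call_conv sub \<delta> = block
     [Const 17 \<delta>, store_entry 19 2 3, Op Add 9 3 19, build_instance,
      reset_registers (reg_bound sub), embed_com sub, Op Add 2 2 4]"

definition query :: "com \<Rightarrow> com" where
  "query sub = block [call_conv sub 0, call_conv sub 1]"

text \<open>The sum of the two answer bits is zero exactly if neither parity gave a hit.\<close>

definition update_entry :: com where
  "update_entry = block
     [Op Add 13 9 5, load_entry 10 9 20, load_entry 11 9 21, Op Add 10 10 11,
      If 10 Skip (block [load_entry 10 13 8, Op Add 10 10 6, store_entry 13 8 10])]"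

text \<open>Parity \<open>0\<close> (register 21) comes first, as \<open>known_double\<close>
  requires. The last instruction clears column 1 for the binary search of the next phase.\<close>

definition final_entry :: com where
  "final_entry = block
     [Op Add 13 9 5, load_entry 10 13 7,
      If 10 Skip (block
        [load_entry 11 13 8, Op Add 11 11 11, Op Add 11 11 5, load_entry 10 9 21,
         If 10 (store_entry 13 7 11)
           (block [load_entry 10 9 20, Op Add 11 11 4, If 10 (store_entry 13 7 11) Skip])]),
      store_entry 13 8 19]"

definition with_answers :: "com \<Rightarrow> com" where
  "with_answers c = block [Op Sub 20 2 4, Op Sub 21 20 4, Op Add 9 3 19, downto0 9 c]"

text \<open>Register 15 holds the next interval length and serves as the loop test of
  \<open>phase\<close>: halving 1 gives 0.\<close>

definition search_round :: "com \<Rightarrow> com" where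
  "search_round sub = block [Op Add 6 15 19, query sub, with_answers update_entry, Op Quot 15 15 5]"

text \<open>When the loop ends, the intervals have length 1 but have not been queried at their final
  positions; the query after the loop does so and reveals the parities.\<close>

definition phase :: "com \<Rightarrow> com" where
  "phase sub = block [Op Quot 15 14 5, While 15 (search_round sub), Op Add 6 4 19, query sub,
     with_answers final_entry, Op Add 14 14 14, Op Lt 16 14 3]"

definition coin_entry :: com where
  "coin_entry = block [Op Add 10 9 5, Load 11 10, store_entry 11 7 4]"

definition output_entry :: com where
  "output_entry = block [Op Add 10 9 4, load_entry 11 10 7, If 11 Skip (Const 11 (- 1)), Store 9 11]"

text \<open>All registers start as \<open>0\<close>, so \<open>Load 3 0\<close> reads cell 0; the
  \<open>1\<close> just put into register 4 is the address of the number of coins. The matrix begins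
  at \<open>n + 2\<close> and has \<open>4 * n + 8\<close> columns.\<close>

definition initialize :: com where
  "initialize = block
     [Load 3 0, Const 4 1, Load 18 4, Const 5 2, Op Add 7 3 5, Op Add 8 7 4, Op Add 2 8 4,
      Op Add 1 3 3, Op Add 1 1 1, Const 10 8, Op Add 1 1 10, Op Add 9 18 19]"

definition coin_change :: "com \<Rightarrow> com" where
  "coin_change sub = block
     [initialize, downto0 9 coin_entry, Op Add 14 4 19, Op Lt 16 14 3, While 16 (phase sub),
      Op Add 9 3 19, downto0 9 output_entry]"

section \<open>Correctness and running time\<close>

text \<open>\<open>w\<close> is the word length of the subroutine and \<open>w'\<close> that of the
  whole program. In \<open>wide\<close> the first factor bounds row numbers, including the addresses
  used by the subroutine, and the second is twice the number of columns; so every address in the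
  matrix is a word.\<close>

locale coin_machine =
  fixes n w w' \<gamma> Tm :: nat and sub :: com
  assumes wide: "(2 ^ (w - 1) + 4 * int n + 10) * (8 * int n + 16) \<le> 2 ^ (w' - 1)"
    and sub: "\<lbrakk>length a = n; length b = n; length c = n;
        \<forall>x \<in> set a \<union> set b \<union> set c. \<bar>x\<bar> \<le> int n ^ \<gamma>\<rbrakk> \<Longrightarrow>
      \<exists>t. computes w sub (int n # a @ b @ c) t (mono_conv a b c) \<and> t \<le> Tm"
    and \<gamma>: "\<gamma> \<ge> 1"
begin

section \<open>The matrix in memory and its addresses\<close>

definition stride :: nat where "stride = 4 * n + 8"

text \<open>The input has at most \<open>n + 2\<close> cells and the output \<open>n\<close>, so
  both lie below the matrix.\<close>

definition base :: nat where "base = n + 2"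

text \<open>Column \<open>0\<close> holds the numbers of coins found so far (\<open>0\<close> if unknown), column \<open>1\<close> the state of
  the binary searches, and each call of the subroutine gets a fresh column as its memory.\<close>

definition col :: "(nat \<Rightarrow> int) \<Rightarrow> nat \<Rightarrow> nat \<Rightarrow> int" where
  "col M k i = (if k < stride then M (base + i * stride + k) else 0)"

definition col_upd :: "(nat \<Rightarrow> int) \<Rightarrow> nat \<Rightarrow> nat \<Rightarrow> int \<Rightarrow> nat \<Rightarrow> int" where
  "col_upd M k i x = M(base + i * stride + k := x)"

text \<open>Row and column are the quotient and the remainder of the offset by
  \<open>stride\<close>, so different entries never share a cell.\<close>

lemma col_col_upd [simp]:
  assumes "k < stride"
  shows "col (col_upd M k i x) = (col M)(k := (col M k)(i := x))"
proof (intro ext)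
  fix k' i'
  have "k' = k \<and> i' = i" if "k' < stride" "i' * stride + k' = i * stride + k"
  proof -
    have "(i' * stride + k') mod stride = k'" "(i * stride + k) mod stride = k"
      "(i' * stride + k') div stride = i'" "(i * stride + k) div stride = i"
      using that(1) assms by simp_all
    with that(2) show ?thesis by metis
  qed
  then show "col (col_upd M k i x) k' i' = ((col M)(k := (col M k)(i := x))) k' i'"
    using assms by (auto simp: col_def col_upd_def add.assoc)
qed

lemma col_upd_below_base [simp]: "a < base \<Longrightarrow> col_upd M k i x a = M a"
  by (simp add: col_upd_def)

definition max_index :: int where "max_index = 2 ^ (w - 1) + 4 * int n + 10"

lemma max_index_ge: "4 * int n + 11 \<le> max_index"
  unfolding max_index_def by simp

lemma is_word_small: "\<bar>x\<bar> \<le> 8 * int n + 16 \<Longrightarrow> is_word w' x"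
proof -
  assume x: "\<bar>x\<bar> \<le> 8 * int n + 16"
  have "\<bar>x\<bar> < 2 * (8 * int n + 16)"
    using x by simp
  also have "2 * (8 * int n + 16) \<le> (2 ^ (w - 1) + 4 * int n + 10) * (8 * int n + 16)"
    by (intro mult_right_mono) (auto simp: add_increasing)
  also note wide
  finally show ?thesis unfolding is_word_def by (simp add: abs_less_iff)
qed

lemma is_word_address:
  assumes "0 \<le> x" "x \<le> max_index" "0 \<le> y" "y < int base + int stride"
  shows "is_word w' (x * int stride + y)"
proof -
  \<comment> \<open>\<open>base\<close> is less than \<open>stride\<close>, so \<open>y\<close>
    contributes less than two further rows.\<close>
  have "x * int stride + y < (x + 2) * int stride"
    using assms by (simp add: algebra_simps base_def stride_def)
  also have "\<dots> \<le> (2 * max_index) * int stride"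
    using assms max_index_ge by (intro mult_right_mono) linarith+
  also have "\<dots> \<le> 2 ^ (w' - 1)"
    using wide by (simp add: stride_def max_index_def algebra_simps)
  finally show ?thesis
    using assms unfolding is_word_def by (auto intro: order_trans[of _ 0])
qed

lemma is_word_mono: "is_word w x \<Longrightarrow> is_word w' x"
proof -
  have "2 ^ (w - 1) * 1 \<le> (2 ^ (w - 1) + 4 * int n + 10) * (8 * int n + 16)"
    by (intro mult_mono) auto
  also note wide
  finally show "is_word w x \<Longrightarrow> is_word w' x" unfolding is_word_def by (intro conjI; linarith)
qed

context
  fixes R :: "nat \<Rightarrow> int" and i b :: nat
  assumes *: "R 1 = int stride" "i \<noteq> 0" "b \<noteq> 0" "0 \<le> R i" "R i \<le> max_index"
    "int base \<le> R b" "R b < int base + int stride"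
begin

lemma entry_address: "nat (R i * int stride + R b) = base + nat (R i) * stride + nat (R b - int base)"
proof -
  have "R i * int stride + R b = int (base + nat (R i) * stride + nat (R b - int base))"
    using * by simp
  then show ?thesis by (metis nat_int)
qed

lemma entry_column: "nat (R b - int base) < stride"
  using * by linarith

lemma wp_load_entry: "wp w' (load_entry r i b) Q (R, M) \<longleftrightarrow>
  Q 4 (R(0 := R i * int stride + R b, r := col M (nat (R b - int base)) (nat (R i))), M)"
  using * entry_column is_word_address[of "R i" "R b"] is_word_address[of "R i" 0]
  by (simp add: load_entry_def col_def entry_address numeral_eq_Suc)

lemma wp_store_entry: "r \<noteq> 0 \<Longrightarrow> wp w' (store_entry i b r) Q (R, M) \<longleftrightarrow>
  Q 4 (R(0 := R i * int stride + R b), col_upd M (nat (R b - int base)) (nat (R i)) (R r))"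
  using * entry_column is_word_address[of "R i" "R b"] is_word_address[of "R i" 0]
  by (simp add: store_entry_def col_upd_def entry_address numeral_eq_Suc)

end

lemma wp_reset_registers:
  assumes "Q (Suc m) (\<lambda>r. if 32 \<le> r \<and> r < m + 32 then 0 else R r, M)"
  shows "wp w' (reset_registers m) Q (R, M)"
proof -
  have "wp w' (block (map (\<lambda>r. Const (r + 32) 0) xs)) Q (R, M)"
    if "Q (Suc (length xs)) (\<lambda>r. if \<exists>x \<in> set xs. r = x + 32 then 0 else R r, M)" for xs Q and R :: "nat \<Rightarrow> int"
    using that
  proof (induction xs arbitrary: R Q)
    case (Cons x xs)
    have "wp w' (block (map (\<lambda>r. Const (r + 32) 0) xs)) (\<lambda>t. Q (Suc t)) (R(x + 32 := 0), M)"
      by (rule Cons.IH) (use Cons.prems in \<open>auto elim!: back_subst[where P = "Q _"] intro!: ext\<close>)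
    then show ?case using is_word_small[of 0] by simp
  qed simp
  moreover have "(\<exists>x \<in> set [0..<m]. r = x + 32) \<longleftrightarrow> 32 \<le> r \<and> r < m + 32" for r
    by (auto simp: le_iff_add)
  ultimately show ?thesis using assms by (simp add: reset_registers_def)
qed

section \<open>Simulation of the subroutine inside one column\<close>

definition simulates :: "nat \<Rightarrow> state \<Rightarrow> state \<Rightarrow> bool" where
  "simulates k s s1 \<longleftrightarrow> (\<forall>r. fst s1 (r + 32) = fst s r) \<and> (\<forall>i. col (snd s1) k i = snd s i)"

text \<open>Words of the subroutine remain words for \<open>w'\<close>, and
  \<open>word_state\<close> bounds the addresses it uses, so the translated accesses do not
  overflow. A memory access becomes four steps, counting the \<open>Skip\<close> that ends a block;
  hence the factor 4.\<close>

lemma wp_embed_com: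
  assumes "exec w c s t s'" "word_state w s" "simulates k s s1"
    "fst s1 1 = int stride" "fst s1 2 = int base + int k" "k < stride"
  shows "wp w' (embed_com c) (\<lambda>t1 s1'. t1 \<le> 4 * t \<and> simulates k s' s1' \<and>
    (\<forall>r. r \<noteq> 0 \<and> r < 32 \<longrightarrow> fst s1' r = fst s1 r) \<and>
    (\<forall>j. j \<noteq> k \<longrightarrow> col (snd s1') j = col (snd s1) j)) s1"
  using assms
proof (induction arbitrary: s1 rule: exec.induct)
  case (Skip s)
  then show ?case by simp
next
  case (Const x r R M)
  then show ?case
    by (cases s1) (auto simp: simulates_def intro: is_word_mono)
next
  case (Op f R p q r M)
  then show ?case
    by (cases s1) (auto simp: simulates_def intro: is_word_mono)
next
  case (Load R p r M)
  have "R p \<le> max_index"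
    using Load.prems(1) by (auto simp: word_state_def is_word_def max_index_def intro: less_imp_le add_increasing2 dest: spec[of _ p])
  with Load show ?case
    by (cases s1) (auto simp: simulates_def wp_load_entry)
next
  case (Store R r p M)
  have "R r \<le> max_index"
    using Store.prems(1) by (auto simp: word_state_def is_word_def max_index_def intro: less_imp_le add_increasing2 dest: spec[of _ r])
  with Store show ?case
    by (cases s1) (auto simp: simulates_def wp_store_entry)
next
  case (Seq c1 s t1 s2 c2 t2 s3)
  have ws: "word_state w s2" using Seq.hyps(1) Seq.prems(1) by (rule exec_word_state)
  show ?case unfolding embed_com.simps wp_Seq
    by (rule wp_mono[OF Seq.IH(1)[OF Seq.prems]], rule wp_mono[OF Seq.IH(2)[OF ws]])
      (use Seq.prems in auto)
next
  case (IfTrue s r c1 t s' c2)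
  have "fst s1 (r + 32) \<noteq> 0"
    using IfTrue.prems(2) IfTrue.hyps(1) by (simp add: simulates_def)
  moreover have "wp w' (embed_com c1) (\<lambda>t1 s1'. 1 + t1 \<le> 4 * (1 + t) \<and> simulates k s' s1' \<and>
    (\<forall>r. r \<noteq> 0 \<and> r < 32 \<longrightarrow> fst s1' r = fst s1 r) \<and>
    (\<forall>j. j \<noteq> k \<longrightarrow> col (snd s1') j = col (snd s1) j)) s1"
    by (rule wp_mono[OF IfTrue.IH[OF IfTrue.prems]]) auto
  ultimately show ?case by simp
next
  case (IfFalse s r c2 t s' c1)
  have "fst s1 (r + 32) = 0"
    using IfFalse.prems(2) IfFalse.hyps(1) by (simp add: simulates_def)
  moreover have "wp w' (embed_com c2) (\<lambda>t1 s1'. 1 + t1 \<le> 4 * (1 + t) \<and> simulates k s' s1' \<and>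
    (\<forall>r. r \<noteq> 0 \<and> r < 32 \<longrightarrow> fst s1' r = fst s1 r) \<and>
    (\<forall>j. j \<noteq> k \<longrightarrow> col (snd s1') j = col (snd s1) j)) s1"
    by (rule wp_mono[OF IfFalse.IH[OF IfFalse.prems]]) auto
  ultimately show ?case by simp
next
  case (WhileFalse s r c)
  then show ?case
    by (auto simp: simulates_def intro!: wpI[OF exec.WhileFalse])
next
  case (WhileTrue s r c t1 s2 t2 s3)
  have ws: "word_state w s2" using WhileTrue.hyps(2) WhileTrue.prems(1) by (rule exec_word_state)
  obtain u1 v1 where 1: "exec w' (embed_com c) s1 u1 v1" "u1 \<le> 4 * t1" "simulates k s2 v1"
    "\<forall>r. r \<noteq> 0 \<and> r < 32 \<longrightarrow> fst v1 r = fst s1 r"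
    "\<forall>j. j \<noteq> k \<longrightarrow> col (snd v1) j = col (snd s1) j"
    using WhileTrue.IH(1)[OF WhileTrue.prems] unfolding wp_def by blast
  have v1: "fst v1 1 = int stride" "fst v1 2 = int base + int k"
    using 1(4) WhileTrue.prems by auto
  obtain u2 v2 where 2: "exec w' (embed_com (While r c)) v1 u2 v2" "u2 \<le> 4 * t2" "simulates k s3 v2"
    "\<forall>r. r \<noteq> 0 \<and> r < 32 \<longrightarrow> fst v2 r = fst v1 r"
    "\<forall>j. j \<noteq> k \<longrightarrow> col (snd v2) j = col (snd v1) j"
    using WhileTrue.IH(2)[OF ws 1(3) v1 WhileTrue.prems(5)] unfolding wp_def by blast
  have "fst s1 (r + 32) \<noteq> 0"
    using WhileTrue.prems(2) WhileTrue.hyps(1) by (simp add: simulates_def)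
  from exec.WhileTrue[OF this 1(1) 2(1)[unfolded embed_com.simps]] show ?case
    unfolding embed_com.simps by (rule wpI) (use 1 2 in auto)
qed

section \<open>A single call: building the instance and reading the answer\<close>

definition constants :: "(nat \<Rightarrow> int) \<Rightarrow> bool" where
  "constants R \<longleftrightarrow> R 1 = int stride \<and> R 3 = int n \<and> R 4 = 1 \<and> R 5 = 2 \<and> R 7 = int base \<and>
     R 8 = int base + 1 \<and> R 19 = 0 \<and> (\<forall>r \<ge> reg_bound sub. R (r + 32) = 0)"

text \<open>Entry \<open>j\<close> stands for the value \<open>j + 1\<close>, so that sums have two
  positive parts. Entries \<open>j\<close> and \<open>i - j\<close> then belong to the value
  \<open>i + 2\<close>: a convolution treats the values from 2 to \<open>n + 1\<close>, which is why
  the invariants range up to \<open>n + 1\<close>.\<close>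

definition left_labels :: "(nat \<Rightarrow> int) \<Rightarrow> int \<Rightarrow> int list" where
  "left_labels F H = map (\<lambda>j. (F (j + 1) - 1) div H) [0..<n]"

definition right_labels :: "(nat \<Rightarrow> int) \<Rightarrow> int \<Rightarrow> int \<Rightarrow> int list" where
  "right_labels F H \<delta> = map (\<lambda>j. (F (j + 1) - 1 - \<delta>) div H) [0..<n]"

definition sum_labels :: "(nat \<Rightarrow> int) \<Rightarrow> int \<Rightarrow> int list" where
  "sum_labels U H = map (\<lambda>i. U (i + 2) div H) [0..<n]"

definition conv_input :: "(nat \<Rightarrow> int) \<Rightarrow> (nat \<Rightarrow> int) \<Rightarrow> int \<Rightarrow> int \<Rightarrow> int list" where
  "conv_input F U H \<delta> = int n # left_labels F H @ right_labels F H \<delta> @ sum_labels U H"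

definition bounded :: "(nat \<Rightarrow> int) \<Rightarrow> (nat \<Rightarrow> int) \<Rightarrow> bool" where
  "bounded F U \<longleftrightarrow> (\<forall>v \<in> {1..n}. F v \<in> {0..int n}) \<and> (\<forall>v \<in> {2..n + 1}. U v \<in> {0..int n})"

text \<open>The least numerator is \<open>- 2\<close>, from an unknown entry with
  \<open>\<delta> = 1\<close>. Floor division by \<open>H\<close> does not go below it because
  \<open>- 2 * H \<le> x\<close>.\<close>

lemma label_bounds:
  fixes x H :: int
  assumes "- 2 \<le> x" "x \<le> int n" "1 \<le> H"
  shows "- 2 \<le> x div H" "x div H \<le> int n"
proof -
  show "x div H \<le> int n"
  proof (cases "0 \<le> x")
    case True
    have "x div H \<le> x" using True assms(3) zdiv_mono2[of x 1 H] by simp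
    then show ?thesis using assms by simp
  next
    case False
    then have "x div H < 0" using assms by (intro div_neg_pos_less0) auto
    then show ?thesis by simp
  qed
  have "- 2 = (- 2) * H div H" using assms nonzero_mult_div_cancel_right[of H "- 2"] by linarith
  also have "\<dots> \<le> x div H" using assms by (intro zdiv_mono1) auto
  finally show "- 2 \<le> x div H" .
qed

text \<open>The column is zero apart from \<open>n\<close> in row 0, so after writing the labels it
  equals an initial memory of the subroutine, including the zeros behind the input.\<close>

lemma wp_build_instance:
  assumes R: "constants R0" "R0 2 = int base + int K" "R0 6 = H" "R0 17 = \<delta>" "R0 9 = int n"
    and K: "2 \<le> K" "K < stride" and H: "1 \<le> H" and \<delta>: "\<delta> = 0 \<or> \<delta> = 1"
    and bnd: "bounded (col M0 0) (col M0 1)"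
    and M0: "\<And>i. col M0 K i = (if i = 0 then int n else 0)"
  shows "wp w' build_instance (\<lambda>t (R, M). t \<le> n * 40 + 1 \<and>
    (\<forall>r. r \<notin> {0, 9, 10, 11, 12, 13} \<longrightarrow> R r = R0 r) \<and>
    col M = (col M0)(K := snd (init_state (conv_input (col M0 0) (col M0 1) H \<delta>)))) (R0, M0)"
proof -
  define F U where "F = col M0 0" and "U = col M0 1"
  define I where "I x s \<longleftrightarrow> (case s of (R, M) \<Rightarrow>
    (\<forall>r. r \<notin> {0, 9, 10, 11, 12, 13} \<longrightarrow> R r = R0 r) \<and> (\<forall>k. k \<noteq> K \<longrightarrow> col M k = col M0 k) \<and>
    col M K 0 = int n \<and> (\<forall>i. 3 * n < i \<longrightarrow> col M K i = 0) \<and>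
    (\<forall>j. x \<le> j \<and> j < n \<longrightarrow> col M K (1 + j) = (F (j + 1) - 1) div H \<and>
      col M K (1 + n + j) = (F (j + 1) - 1 - \<delta>) div H \<and>
      col M K (1 + n + n + j) = U (j + 2) div H))" for x and s :: state
  have step: "wp w' build_entry
     (\<lambda>t (R', M'). t \<le> 38 \<and> R' 9 = int x \<and> I x (R', M')) (R(9 := int x), M)"
    if x: "x < n" and I: "I (Suc x) (R, M)" for x R M
  proof -
    have F: "0 \<le> F (Suc x)" "F (Suc x) \<le> int n" and U: "0 \<le> U (Suc (Suc x))" "U (Suc (Suc x)) \<le> int n"
      using bnd x by (auto simp: F_def U_def bounded_def)
    have same: "R r = R0 r" if "r \<notin> {0, 9, 10, 11, 12, 13}" for r
      using I that by (auto simp: I_def)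
    have regs: "R (Suc 0) = int stride" "R 2 = int base + int K" "R 3 = int n" "R 4 = 1" "R 5 = 2"
      "R 6 = H" "R 7 = int base" "R 8 = int base + 1" "R 17 = \<delta>"
      using R same by (auto simp: constants_def)
    have cols: "col M 0 = F" "col M (Suc 0) = U"
      using I K by (auto simp: I_def F_def U_def)
    have ix: "int x + 2 + int n + int n \<le> max_index"
      using x max_index_ge by linarith
    have words: "is_word w' (int x + 1)" "is_word w' (int x + 2)" "is_word w' (F (Suc x) - 1)"
      "is_word w' ((F (Suc x) - 1) div H)" "is_word w' (F (Suc x) - 1 - \<delta>)"
      "is_word w' ((F (Suc x) - 1 - \<delta>) div H)" "is_word w' (int x + 1 + int n)"
      "is_word w' (int x + 1 + int n + int n)" "is_word w' (U (Suc (Suc x)) div H)"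
      using x F U \<delta> H label_bounds[of "F (Suc x) - 1" H] label_bounds[of "F (Suc x) - 1 - \<delta>" H]
        label_bounds[of "U (Suc (Suc x))" H]
      by (auto intro!: is_word_small simp: abs_le_iff)
    have nats: "nat (int x + 1) = Suc x" "nat (int x + 2) = Suc (Suc x)"
      "nat (int x + 1 + int n) = Suc (x + n)" "nat (int x + 1 + int n + int n) = Suc (x + n + n)"
      by (simp_all add: nat_add_distrib)
    have stride: "1 < stride" using K by simp
    show ?thesis
      using I K x ix stride words
      by (simp add: build_entry_def wp_load_entry wp_store_entry regs cols nats) (auto simp: I_def)
  qed
  have "wp w' (downto0 9 build_entry)
      (\<lambda>t (R, M). t \<le> n * (38 + 2) + 1 \<and> I 0 (R, M)) (R0, M0)"
  proof (rule wp_downto0[where I = I and N = n and B = 38])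
    show "I n (R0, M0)" by (auto simp: I_def M0)
    show "is_word w' (int n)" by (rule is_word_small) simp
    show "R 4 = 1" if "I x (R, M)" for x R M using that R by (auto simp: I_def constants_def)
    show "R0 9 = int n" by (rule R)
    show "wp w' build_entry (\<lambda>t (R', M'). t \<le> 38 \<and> R' 9 = int x \<and> I x (R', M')) (R(9 := int x), M)"
      if "x < n" "I (Suc x) (R, M)" for x R M using that by (rule step)
  qed
  moreover have "col M = (col M0)(K := snd (init_state (conv_input F U H \<delta>)))" if "I 0 (R, M)" for R M
  proof (intro ext)
    fix k i
    have "col M K i = snd (init_state (conv_input F U H \<delta>)) i"
    proof -
      consider "i = 0" | j where "j < n" "i = 1 + j" | j where "j < n" "i = 1 + n + j"
        | j where "j < n" "i = 1 + n + n + j" | "3 * n < i"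
      proof -
        have "i = 0 \<or> 1 \<le> i \<and> i < 1 + n \<or> 1 + n \<le> i \<and> i < 1 + n + n \<or>
          1 + n + n \<le> i \<and> i < 1 + n + n + n \<or> 3 * n < i" by linarith
        then show ?thesis using that by (metis nat_add_left_cancel_less le_iff_add)
      qed
      then show ?thesis
        using that
        by cases (auto simp: I_def init_state_def conv_input_def nth_append left_labels_def
            right_labels_def sum_labels_def)
    qed
    then show "col M k i = ((col M0)(K := snd (init_state (conv_input F U H \<delta>)))) k i"
      using that by (auto simp: I_def)
  qed
  ultimately show ?thesis
    unfolding build_instance_def F_def[symmetric] U_def[symmetric]
    by (elim wp_mono) (auto simp: I_def)
qed

lemma word_state_init_state: "\<forall>x \<in> set xs. is_word w x \<Longrightarrow> word_state w (init_state xs)"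
  by (auto simp: word_state_def init_state_def is_word_def)

text \<open>By \<open>n \<ge> 2\<close> and \<open>\<gamma> \<ge> 1\<close>, even the label
  \<open>- 2\<close> respects the bound \<open>n ^ \<gamma>\<close> on entries.\<close>

lemma conv_input_solved:
  assumes n: "n \<ge> 2" and H: "1 \<le> H" and \<delta>: "\<delta> = 0 \<or> \<delta> = 1" and bnd: "bounded F U"
  shows "\<exists>t. computes w sub (conv_input F U H \<delta>) t
    (mono_conv (left_labels F H) (right_labels F H \<delta>) (sum_labels U H)) \<and> t \<le> Tm"
  unfolding conv_input_def
proof (rule sub)
  have "int n \<le> int n ^ \<gamma>" using n \<gamma> by (simp add: self_le_power)
  then have bound: "\<bar>x div H\<bar> \<le> int n ^ \<gamma>" if "- 2 \<le> x" "x \<le> int n" for x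
    using label_bounds[OF that H] n by linarith
  have "F (Suc j) \<in> {0..int n}" "U (Suc (Suc j)) \<in> {0..int n}" if "j < n" for j
    using bnd that by (auto simp: bounded_def)
  then have "- 2 \<le> F (Suc j) - 1" "F (Suc j) - 1 \<le> int n" "- 2 \<le> F (Suc j) - 1 - \<delta>"
    "F (Suc j) - 1 - \<delta> \<le> int n" "- 2 \<le> U (Suc (Suc j))" "U (Suc (Suc j)) \<le> int n"
    if "j < n" for j
    using \<delta> that by force+
  then show "\<forall>x \<in> set (left_labels F H) \<union> set (right_labels F H \<delta>) \<union> set (sum_labels U H).
      \<bar>x\<bar> \<le> int n ^ \<gamma>"
    by (auto simp: left_labels_def right_labels_def sum_labels_def intro!: bound)
qed (simp_all add: left_labels_def right_labels_def sum_labels_def)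

definition conv_time :: nat where
  "conv_time = 40 * n + 4 * Tm + reg_bound sub + 20"

lemma wp_call_conv:
  assumes R: "constants R0" "R0 2 = int base + int K" "R0 6 = H"
    and K: "2 \<le> K" "K < stride" and H: "1 \<le> H" and \<delta>: "\<delta> = 0 \<or> \<delta> = 1" and n: "n \<ge> 2"
    and bnd: "bounded (col M0 0) (col M0 1)" and fresh: "\<And>i. col M0 K i = 0"
  shows "wp w' (call_conv sub \<delta>) (\<lambda>t (R, M). t \<le> conv_time \<and> constants R \<and>
    R 2 = int base + int (Suc K) \<and> R 6 = R0 6 \<and> R 14 = R0 14 \<and> R 15 = R0 15 \<and>
    (\<forall>k. k \<noteq> K \<longrightarrow> col M k = col M0 k) \<and>
    (\<forall>i < n. col M K i = mono_conv (left_labels (col M0 0) H) (right_labels (col M0 0) H \<delta>)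
      (sum_labels (col M0 1) H) ! i)) (R0, M0)"
proof -
  define F U where "F = col M0 0" and "U = col M0 1"
  define xs where "xs = conv_input F U H \<delta>"
  define ys where "ys = mono_conv (left_labels F H) (right_labels F H \<delta>) (sum_labels U H)"
  obtain t where t: "computes w sub xs t ys" "t \<le> Tm"
    using conv_input_solved[OF n H \<delta> bnd] by (auto simp: xs_def ys_def F_def U_def)
  then obtain Rs Ms where run: "exec w sub (init_state xs) t (Rs, Ms)"
    and out: "\<And>i. i < length ys \<Longrightarrow> Ms i = ys ! i" and ws: "word_state w (init_state xs)"
    unfolding computes_def using word_state_init_state by blast
  have len: "length ys = n" by (simp add: ys_def mono_conv_def sum_labels_def)
  have regs: "R0 (Suc 0) = int stride" "R0 2 = int base + int K" "R0 3 = int n" "R0 4 = 1"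
    "R0 5 = 2" "R0 6 = H" "R0 7 = int base" "R0 8 = int base + 1" "R0 19 = 0"
    "\<And>r. reg_bound sub \<le> r \<Longrightarrow> R0 (r + 32) = 0"
    using R by (auto simp: constants_def)
  have words: "is_word w' \<delta>" "is_word w' (int n)" "is_word w' (int base + int K + 1)"
    using \<delta> K by (auto intro!: is_word_small simp: base_def stride_def)
  define P where "P R M \<longleftrightarrow> constants R \<and>
    R 2 = int base + int (Suc K) \<and> R 6 = R0 6 \<and> R 14 = R0 14 \<and> R 15 = R0 15 \<and>
    (\<forall>k. k \<noteq> K \<longrightarrow> col M k = col M0 k) \<and>
    (\<forall>i < n. col M K i = ys ! i)" for R M
  define R1 where "R1 = R0(17 := \<delta>, 0 := int base + int K, 9 := int n)"
  define M1 where "M1 = col_upd M0 K 0 (int n)"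
  have 1: "wp w' build_instance (\<lambda>t (R, M). t \<le> n * 40 + 1 \<and>
    (\<forall>r. r \<notin> {0, 9, 10, 11, 12, 13} \<longrightarrow> R r = R1 r) \<and>
    col M = (col M1)(K := snd (init_state (conv_input (col M1 0) (col M1 1) H \<delta>)))) (R1, M1)"
    by (rule wp_build_instance)
      (use regs K H \<delta> bnd fresh in \<open>auto simp: R1_def M1_def constants_def F_def U_def\<close>)
  have col1: "col M1 0 = F" "col M1 1 = U"
    using K by (auto simp: M1_def F_def U_def)
  define rest where
    "rest = Seq (reset_registers (reg_bound sub)) (Seq (embed_com sub) (Seq (Op Add 2 2 4) Skip))"
  have 2: "wp w' rest
    (\<lambda>t (R, M). t \<le> reg_bound sub + 4 * Tm + 3 \<and> P R M) (R2, M2)"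
    if R2: "\<forall>r. r \<notin> {0, 9, 10, 11, 12, 13} \<longrightarrow> R2 r = R1 r"
      and M2: "col M2 = (col M1)(K := snd (init_state xs))" for R2 M2
  proof -
    define R3 where "R3 = (\<lambda>r. if 32 \<le> r \<and> r < reg_bound sub + 32 then 0 else R2 r)"
    have R3: "R3 r = R1 r" if "r < 32" "r \<notin> {0, 9, 10, 11, 12, 13}" for r
      using that R2 by (auto simp: R3_def)
    \<comment> \<open>Below \<open>reg_bound sub\<close> the reset applies, from there on the last
      conjunct of \<open>constants\<close>.\<close>
    have "R3 (r + 32) = 0" for r
      using R2 regs(10)[of r] by (auto simp: R3_def R1_def)
    then have sim: "simulates K (init_state xs) (R3, M2)"
      by (simp add: simulates_def M2 init_state_def)
    have "wp w' (embed_com sub) (\<lambda>t1 s1'. t1 \<le> 4 * t \<and> simulates K (Rs, Ms) s1' \<and>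
      (\<forall>r. r \<noteq> 0 \<and> r < 32 \<longrightarrow> fst s1' r = fst (R3, M2) r) \<and>
      (\<forall>j. j \<noteq> K \<longrightarrow> col (snd s1') j = col (snd (R3, M2)) j)) (R3, M2)"
      by (rule wp_embed_com[OF run ws sim]) (use R3 regs K in \<open>auto simp: R1_def\<close>)
    \<comment> \<open>This restores the last conjunct of \<open>constants\<close> after the
      call.\<close>
    moreover have "Rs r = 0" if "reg_bound sub \<le> r" for r
      using exec_unwritten_register[OF run that] by (simp add: init_state_def)
    moreover have "col M1 k = col M0 k" if "k \<noteq> K" for k
      using that K by (auto simp: M1_def)
    ultimately have "wp w' (Seq (embed_com sub) (Seq (Op Add 2 2 4) Skip))
      (\<lambda>t (R, M). Suc (reg_bound sub) + t \<le> reg_bound sub + 4 * Tm + 3 \<and> P R M) (R3, M2)"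
      using words regs R3 M2 out len t(2)
      by (auto elim!: wp_mono simp: P_def simulates_def constants_def R1_def)
    then show ?thesis
      unfolding rest_def wp_Seq[of _ "reset_registers _"]
      by (intro wp_reset_registers) (auto simp: R3_def elim!: wp_mono)
  qed
  define main where "main = Seq build_instance rest"
  have 3: "wp w' main (\<lambda>t (R, M). t + 6 \<le> conv_time \<and> P R M) (R1, M1)"
    unfolding main_def wp_Seq
  proof (rule wp_mono[OF 1], clarify)
    fix t1 R2 M2
    assume "t1 \<le> n * 40 + 1" and R2: "\<forall>r. r \<notin> {0, 9, 10, 11, 12, 13} \<longrightarrow> R2 r = R1 r"
      and "col M2 = (col M1)(K := snd (init_state (conv_input (col M1 0) (col M1 1) H \<delta>)))"
    then show "wp w' rest (\<lambda>t2 (R, M). t1 + t2 + 6 \<le> conv_time \<and> P R M) (R2, M2)"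
      by (intro wp_mono[OF 2[OF R2]]) (auto simp: xs_def col1[unfolded One_nat_def] conv_time_def)
  qed
  have "call_conv sub \<delta> = Seq (Const 17 \<delta>) (Seq (store_entry 19 2 3)
    (Seq (Op Add 9 3 19) main))"
    by (simp add: call_conv_def main_def rest_def)
  moreover have "0 \<le> max_index" using max_index_ge by linarith
  ultimately have "wp w' (call_conv sub \<delta>) (\<lambda>t (R, M). t \<le> conv_time \<and> P R M) (R0, M0)"
    using words K
    by (simp add: wp_store_entry regs R1_def[symmetric] M1_def[symmetric])
      (auto intro: wp_mono[OF 3])
  then show ?thesis by (simp add: P_def ys_def F_def U_def)
qed

lemma mono_conv_eq_hit:
  assumes i: "i < n"
  shows "mono_conv (left_labels F H) (right_labels F H \<delta>) (sum_labels U H) ! i =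
    of_bool (hit n F U H \<delta> (i + 2))"
proof -
  have "(\<exists>j \<le> i. left_labels F H ! j = right_labels F H \<delta> ! (i - j) \<and>
      right_labels F H \<delta> ! (i - j) = sum_labels U H ! i) \<longleftrightarrow> hit n F U H \<delta> (i + 2)"
    (is "?L \<longleftrightarrow> ?R")
  proof
    assume ?L
    then obtain j where "j \<le> i" "(F (j + 1) - 1) div H = U (i + 2) div H"
      "(F (i - j + 1) - 1 - \<delta>) div H = U (i + 2) div H"
      using i by (auto simp: left_labels_def right_labels_def sum_labels_def)
    then show ?R
      using i unfolding hit_def by (intro exI[of _ "j + 1"] exI[of _ "i - j + 1"]) auto
  next
    assume ?R
    then obtain j j' where j: "j \<in> {1..n}" "j' \<in> {1..n}" "i + 2 = j + j'"
      "(F j - 1) div H = U (i + 2) div H" "(F j' - 1 - \<delta>) div H = U (i + 2) div H"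
      unfolding hit_def by blast
    have "i - (j - 1) = j' - 1" "j - 1 \<le> i" using j(1-3) by auto
    then show ?L
      using i j by (intro exI[of _ "j - 1"])
        (auto simp: left_labels_def right_labels_def sum_labels_def)
  qed
  with i show ?thesis by (auto simp: mono_conv_def sum_labels_def)
qed

section \<open>Queries for both parities and the loops that use their answers\<close>

definition calls_done :: "nat \<Rightarrow> (nat \<Rightarrow> int) \<Rightarrow> (nat \<Rightarrow> int) \<Rightarrow> bool" where
  "calls_done K R M \<longleftrightarrow> constants R \<and> R 2 = int base + int K \<and> (\<forall>k \<ge> K. \<forall>i. col M k i = 0)"

definition same_progress :: "(nat \<Rightarrow> int) \<Rightarrow> (nat \<Rightarrow> int) \<Rightarrow> bool" where
  "same_progress R R' \<longleftrightarrow> R' 6 = R 6 \<and> R' 14 = R 14 \<and> R' 15 = R 15"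

text \<open>The first call answers parity \<open>0\<close> in column \<open>K\<close>, the second
  parity \<open>1\<close> in column \<open>K + 1\<close>. The columns from \<open>K + 2\<close> on
  remain zero, ready for later calls.\<close>

lemma wp_query:
  assumes R: "calls_done K R0 M0" "R0 6 = H" "1 \<le> H"
    and K: "2 \<le> K" "K + 1 < stride" and n: "n \<ge> 2"
    and bnd: "bounded (col M0 0) (col M0 1)"
  shows "wp w' (query sub) (\<lambda>t (R, M). t \<le> 2 * conv_time + 1 \<and> calls_done (K + 2) R M \<and>
    same_progress R0 R \<and> col M 0 = col M0 0 \<and> col M 1 = col M0 1 \<and>
    (\<forall>i < n. col M K i = of_bool (hit n (col M0 0) (col M0 1) H 0 (i + 2)) \<and>
       col M (K + 1) i = of_bool (hit n (col M0 0) (col M0 1) H 1 (i + 2)))) (R0, M0)"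
proof -
  define P where "P \<delta> K R M R' M' \<longleftrightarrow> constants R' \<and>
    R' 2 = int base + int (Suc K) \<and> R' 6 = R 6 \<and> R' 14 = R 14 \<and> R' 15 = R 15 \<and>
    (\<forall>k. k \<noteq> K \<longrightarrow> col M' k = col M k) \<and>
    (\<forall>i < n. col M' K i = of_bool (hit n (col M 0) (col M 1) H \<delta> (i + 2)))"
    for \<delta> :: int and K :: nat and R M R' M' :: "nat \<Rightarrow> int"
  have call: "wp w' (call_conv sub \<delta>) (\<lambda>t (R', M'). t \<le> conv_time \<and> P \<delta> K R M R' M') (R, M)"
    if "calls_done K R M" "R 6 = H" "2 \<le> K" "K < stride" "\<delta> = 0 \<or> \<delta> = 1"
      "bounded (col M 0) (col M 1)" for \<delta> K R M
  proof -
    have "wp w' (call_conv sub \<delta>) (\<lambda>t (R', M'). t \<le> conv_time \<and> constants R' \<and>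
      R' 2 = int base + int (Suc K) \<and> R' 6 = R 6 \<and> R' 14 = R 14 \<and> R' 15 = R 15 \<and>
      (\<forall>k. k \<noteq> K \<longrightarrow> col M' k = col M k) \<and>
      (\<forall>i < n. col M' K i = mono_conv (left_labels (col M 0) H) (right_labels (col M 0) H \<delta>)
        (sum_labels (col M 1) H) ! i)) (R, M)"
      by (rule wp_call_conv) (use that R n in \<open>auto simp: calls_done_def\<close>)
    then show ?thesis
      by (rule wp_mono) (auto simp: P_def mono_conv_eq_hit)
  qed
  show ?thesis
    unfolding query_def block.simps wp_Seq wp_Skip
  proof (rule wp_mono[OF call[OF R(1,2) K(1)]], goal_cases)
    case (4 t1 s1)
    then obtain R1 M1 where s1: "s1 = (R1, M1)" "t1 \<le> conv_time" "P 0 K R0 M0 R1 M1" by auto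
    have "calls_done (Suc K) R1 M1"
      using s1(3) R(1) by (auto simp: calls_done_def P_def)
    moreover have "R1 6 = H" "bounded (col M1 0) (col M1 1)"
      using s1(3) R(2) K bnd by (auto simp: P_def)
    ultimately have "wp w' (call_conv sub 1) (\<lambda>t (R', M'). t \<le> conv_time \<and> P 1 (Suc K) R1 M1 R' M') s1"
      unfolding s1(1) using K by (intro call) auto
    then show ?case
      by (rule wp_mono) (use s1 K R(1) in \<open>auto simp: P_def calls_done_def same_progress_def\<close>)
  qed (use K bnd in auto)
qed

lemma wp_with_answers:
  assumes const: "constants R0" and R2: "R0 2 = int base + int K + 2" "K + 2 \<le> stride"
    and I: "I n (R0(20 := int base + int K + 1, 21 := int base + int K, 9 := int n), M0)"
    and const_I: "\<And>x R M. I x (R, M) \<Longrightarrow> R 4 = 1"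
    and step: "\<And>x R M. x < n \<Longrightarrow> I (Suc x) (R, M) \<Longrightarrow>
      wp w' c (\<lambda>t (R', M'). t \<le> B \<and> R' 9 = int x \<and> I x (R', M')) (R(9 := int x), M)"
  shows "wp w' (with_answers c) (\<lambda>t (R, M). t \<le> n * (B + 2) + 5 \<and> I 0 (R, M)) (R0, M0)"
proof -
  define main where "main = downto0 9 c"
  let ?R = "R0(20 := int base + int K + 1, 21 := int base + int K, 9 := int n)"
  have "wp w' main (\<lambda>t (R, M). t \<le> n * (B + 2) + 1 \<and> I 0 (R, M)) (?R, M0)"
    unfolding main_def
    by (rule wp_downto0[where I = I and B = B])
      (use I const_I step in \<open>auto intro!: is_word_small\<close>)
  then have "wp w' main (\<lambda>t (R, M). t + 4 \<le> n * (B + 2) + 5 \<and> I 0 (R, M)) (?R, M0)"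
    by (rule wp_mono) auto
  moreover have "is_word w' (int base + int K)" "is_word w' (1 + (int base + int K))"
    "is_word w' (int n)"
    using R2 by (auto intro!: is_word_small simp: base_def stride_def)
  ultimately show ?thesis
    using const R2 unfolding with_answers_def main_def[symmetric]
    by (auto simp: constants_def algebra_simps elim!: wp_mono)
qed

text \<open>\<open>h0\<close> and \<open>h1\<close> stand for the hits of the two parities; the
  resulting column 1 is the \<open>U'\<close> of \<open>search_step\<close>.\<close>

lemma wp_update:
  assumes R: "calls_done (K + 2) R0 M0" "R0 6 = int G"
    and K: "2 \<le> K" "K + 2 \<le> stride" and G: "G \<le> n"
    and U: "\<And>v. v \<in> {2..n + 1} \<Longrightarrow> 0 \<le> col M0 1 v \<and> col M0 1 v \<le> int n"
    and ans: "\<And>i. i < n \<Longrightarrow> col M0 K i = of_bool (h0 (i + 2)) \<and> col M0 (K + 1) i = of_bool (h1 (i + 2))"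
  shows "wp w' (with_answers update_entry) (\<lambda>t (R, M). t \<le> n * 30 + 5 \<and> calls_done (K + 2) R M \<and>
    same_progress R0 R \<and> col M 0 = col M0 0 \<and>
    (\<forall>v \<in> {2..n + 1}. col M 1 v = (if h0 v \<or> h1 v then col M0 1 v else col M0 1 v + int G)) \<and>
    (\<forall>v. v \<notin> {2..n + 1} \<longrightarrow> col M 1 v = col M0 1 v)) (R0, M0)"
proof -
  define U where "U = col M0 1"
  let ?R = "R0(20 := int base + int K + 1, 21 := int base + int K, 9 := int n)"
  define I where "I x s \<longleftrightarrow> (case s of (R, M) \<Rightarrow>
    (\<forall>r. r \<notin> {0, 9, 10, 11, 13} \<longrightarrow> R r = ?R r) \<and> (\<forall>k. k \<noteq> 1 \<longrightarrow> col M k = col M0 k) \<and>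
    (\<forall>v. col M 1 v = (if v \<in> {x + 2..n + 1} \<and> \<not> h0 v \<and> \<not> h1 v then U v + int G else U v)))"
    for x and s :: state
  have step: "wp w' update_entry (\<lambda>t (R', M'). t \<le> 28 \<and> R' 9 = int x \<and> I x (R', M')) (R(9 := int x), M)"
    if x: "x < n" and I: "I (Suc x) (R, M)" for x R M
  proof -
    have Ux: "0 \<le> U (x + 2)" "U (x + 2) \<le> int n"
      using U[of "x + 2"] x by (auto simp: U_def)
    have same: "R r = ?R r" if "r \<notin> {0, 9, 10, 11, 13}" for r
      using I that by (auto simp: I_def)
    have regs: "R (Suc 0) = int stride" "R 4 = 1" "R 5 = 2" "R 6 = int G" "R 8 = int base + 1"
      "R 20 = int base + int K + 1" "R 21 = int base + int K"
      using R same by (auto simp: constants_def calls_done_def)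
    have cols: "col M K x = of_bool (h0 (x + 2))" "col M (Suc K) x = of_bool (h1 (x + 2))"
      "col M (Suc 0) (Suc (Suc x)) = U (x + 2)"
      using I K ans[OF x] by (auto simp: I_def)
    have words: "is_word w' (int x + 2)" "is_word w' 0" "is_word w' 1" "is_word w' 2"
      "is_word w' (U (x + 2) + int G)"
      using x Ux G by (auto intro!: is_word_small)
    have ix: "int x + 2 \<le> max_index" "int x \<le> max_index" "0 \<le> max_index"
      using x max_index_ge by linarith+
    have nats: "nat (int x + 2) = Suc (Suc x)" "nat (1 + int K) = Suc K" "nat (int K + 1) = Suc K"
      by (simp_all add: nat_add_distrib)
    have next_index: "Suc (Suc x) \<le> v \<longleftrightarrow> v = Suc (Suc x) \<or> Suc (Suc (Suc x)) \<le> v" for v by auto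
    show ?thesis
      using I K x ix words
      by (simp add: update_entry_def wp_load_entry wp_store_entry regs cols nats)
        (auto simp: I_def cols next_index)
  qed
  have "wp w' (with_answers update_entry) (\<lambda>t (R, M). t \<le> n * (28 + 2) + 5 \<and> I 0 (R, M)) (R0, M0)"
  proof (rule wp_with_answers[where I = I and B = 28 and K = K])
    show "constants R0" "R0 2 = int base + int K + 2" using R by (auto simp: calls_done_def)
    show "I n (?R, M0)" by (auto simp: I_def U_def)
    show "R 4 = 1" if "I x (R, M)" for x R M
      using that R by (auto simp: I_def constants_def calls_done_def)
  qed (use K step in auto)
  then show ?thesis
    by (rule wp_mono)
      (use R K in \<open>auto simp: I_def U_def calls_done_def same_progress_def constants_def\<close>)
qed

text \<open>The new column 0 is the \<open>F'\<close> of \<open>known_double\<close>, and the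
  cleared column 1 prepares for \<open>search_init\<close>.\<close>

lemma wp_final:
  assumes R: "calls_done (K + 2) R0 M0" "n \<ge> 2"
    and K: "2 \<le> K" "K + 2 \<le> stride"
    and U: "\<And>v. v \<in> {2..n + 1} \<Longrightarrow> 0 \<le> col M0 1 v \<and> col M0 1 v \<le> int n"
    and F: "\<And>v. v \<in> {2..n + 1} \<Longrightarrow> \<bar>col M0 0 v\<bar> \<le> int n + 1"
    and ans: "\<And>i. i < n \<Longrightarrow> col M0 K i = of_bool (h0 (i + 2)) \<and> col M0 (K + 1) i = of_bool (h1 (i + 2))"
  shows "wp w' (with_answers final_entry) (\<lambda>t (R, M). t \<le> n * 40 + 5 \<and> calls_done (K + 2) R M \<and>
    same_progress R0 R \<and>
    (\<forall>v \<in> {2..n + 1}. col M 1 v = 0 \<and> col M 0 v = (if col M0 0 v \<noteq> 0 then col M0 0 v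
      else if h0 v then 2 * col M0 1 v + 2 else if h1 v then 2 * col M0 1 v + 3 else 0)) \<and>
    (\<forall>v. v \<notin> {2..n + 1} \<longrightarrow> col M 0 v = col M0 0 v \<and> col M 1 v = col M0 1 v)) (R0, M0)"
proof -
  define U where "U = col M0 1"
  define F where "F = col M0 0"
  define F' where "F' v = (if F v \<noteq> 0 then F v
      else if h0 v then 2 * U v + 2 else if h1 v then 2 * U v + 3 else 0)" for v
  let ?R = "R0(20 := int base + int K + 1, 21 := int base + int K, 9 := int n)"
  define I where "I x s \<longleftrightarrow> (case s of (R, M) \<Rightarrow>
    (\<forall>r. r \<notin> {0, 9, 10, 11, 13} \<longrightarrow> R r = ?R r) \<and> (\<forall>k. k \<notin> {0, 1} \<longrightarrow> col M k = col M0 k) \<and>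
    (\<forall>v. col M 0 v = (if v \<in> {x + 2..n + 1} then F' v else F v) \<and>
         col M 1 v = (if v \<in> {x + 2..n + 1} then 0 else U v)))"
    for x and s :: state
  have step: "wp w' final_entry (\<lambda>t (R', M'). t \<le> 38 \<and> R' 9 = int x \<and> I x (R', M')) (R(9 := int x), M)"
    if x: "x < n" and I: "I (Suc x) (R, M)" for x R M
  proof -
    have Ux: "0 \<le> U (x + 2)" "U (x + 2) \<le> int n"
      using U[of "x + 2"] x by (auto simp: U_def)
    have same: "R r = ?R r" if "r \<notin> {0, 9, 10, 11, 13}" for r
      using I that by (auto simp: I_def)
    have regs: "R (Suc 0) = int stride" "R 4 = 1" "R 5 = 2" "R 7 = int base" "R 8 = int base + 1"
      "R 19 = 0" "R 20 = int base + int K + 1" "R 21 = int base + int K"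
      using R same by (auto simp: constants_def calls_done_def)
    have cols: "col M K x = of_bool (h0 (x + 2))" "col M (Suc K) x = of_bool (h1 (x + 2))"
      "col M (Suc 0) (Suc (Suc x)) = U (x + 2)" "col M 0 (Suc (Suc x)) = F (x + 2)"
      using I K ans[OF x] by (auto simp: I_def)
    have words: "is_word w' (int x + 2)"
      "is_word w' (U (x + 2) + U (x + 2))" "is_word w' (U (x + 2) + U (x + 2) + 2)"
      "is_word w' (U (x + 2) + U (x + 2) + 2 + 1)"
      using x Ux by (auto intro!: is_word_small)
    have ix: "int x + 2 \<le> max_index" "int x \<le> max_index" "0 \<le> max_index"
      using x max_index_ge by linarith+
    have nats: "nat (int x + 2) = Suc (Suc x)" "nat (1 + int K) = Suc K" "nat (int K + 1) = Suc K"
      by (simp_all add: nat_add_distrib)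
    have F'x: "F' (Suc (Suc x)) = (if F (x + 2) \<noteq> 0 then F (x + 2)
      else if h0 (x + 2) then U (x + 2) + U (x + 2) + 2
      else if h1 (x + 2) then U (x + 2) + U (x + 2) + 2 + 1 else 0)"
      by (simp add: F'_def)
    have next_index: "Suc (Suc x) \<le> v \<longleftrightarrow> v = Suc (Suc x) \<or> Suc (Suc (Suc x)) \<le> v" for v by auto
    show ?thesis
      using I K x ix words
      by (simp add: final_entry_def wp_load_entry wp_store_entry regs cols nats)
        (auto simp: I_def cols F'x next_index)
  qed
  have "wp w' (with_answers final_entry) (\<lambda>t (R, M). t \<le> n * (38 + 2) + 5 \<and> I 0 (R, M)) (R0, M0)"
  proof (rule wp_with_answers[where I = I and B = 38 and K = K])
    show "constants R0" "R0 2 = int base + int K + 2" using R by (auto simp: calls_done_def)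
    show "I n (?R, M0)" by (auto simp: I_def U_def F_def)
    show "R 4 = 1" if "I x (R, M)" for x R M
      using that R by (auto simp: I_def constants_def calls_done_def)
  qed (use K step in auto)
  then show ?thesis
    by (rule wp_mono)
      (use R K in \<open>auto simp: I_def U_def F_def F'_def calls_done_def same_progress_def constants_def\<close>)
qed

text \<open>These bounds keep labels admissible and register contents within words. The entry for
  \<open>n + 1\<close> may be as large as \<open>n + 1\<close>, but only values up to
  \<open>n\<close> occur as parts of a sum, and \<open>bounded\<close> restricts \<open>F\<close>
  just there.\<close>

lemma known_search_bounds:
  assumes "known n C S F" "search n C S H U" "0 \<le> H" "S \<le> int n" "0 \<notin> C"
  shows "bounded F U" and "v \<in> {2..n + 1} \<Longrightarrow> 0 \<le> U v \<and> U v \<le> int n"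
    and "v \<in> {2..n + 1} \<Longrightarrow> \<bar>F v\<bar> \<le> int n + 1"
proof -
  have U: "0 \<le> U v \<and> U v \<le> int n" if "v \<in> {2..n + 1}" for v
  proof -
    have "0 \<le> U v" "U v + H \<le> S" using assms(2) that unfolding search_def by auto
    with assms show ?thesis by simp
  qed
  then show "v \<in> {2..n + 1} \<Longrightarrow> 0 \<le> U v \<and> U v \<le> int n" .
  have F: "0 \<le> F v \<and> F v \<le> int v" if "v \<in> {1..n + 1}" for v
    using known_bounds[OF assms(1,5) that] by simp
  show "v \<in> {2..n + 1} \<Longrightarrow> \<bar>F v\<bar> \<le> int n + 1"
    using F[of v] by simp
  have "F v \<in> {0..int n}" if "v \<in> {1..n}" for v
    using F[of v] that by auto
  then show "bounded F U"
    using U by (auto simp: bounded_def)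
qed

section \<open>One search round and one phase\<close>

definition round_time :: nat where
  "round_time = 2 * conv_time + 40 * n + 20"

lemma wp_round:
  assumes R: "calls_done K R0 M0" "R0 15 = 2 ^ y"
    and K: "2 \<le> K" "K + 2 \<le> stride" and n: "n \<ge> 2" and C: "0 \<notin> C" and S: "S \<le> int n"
    and kn: "known n C S (col M0 0)" and se: "search n C S (2 * 2 ^ y) (col M0 1)"
  shows "wp w' (search_round sub) (\<lambda>t (R, M). t \<le> round_time \<and> calls_done (K + 2) R M \<and>
    R 14 = R0 14 \<and> R 15 = 2 ^ y div 2 \<and> col M 0 = col M0 0 \<and>
    search n C S (2 ^ y) (col M 1) \<and> (\<forall>v. v \<notin> {2..n + 1} \<longrightarrow> col M 1 v = col M0 1 v)) (R0, M0)"
proof -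
  let ?R = "R0(6 := 2 ^ y)"
  \<comment> \<open>The interval for the value 2 ends at \<open>S\<close> or before, which bounds
    the interval length by \<open>n\<close>.\<close>
  have "0 \<le> col M0 1 2 \<and> col M0 1 2 + 2 * 2 ^ y \<le> S"
    using se n unfolding search_def by auto
  moreover have "0 < (2 :: int) ^ y" by simp
  ultimately have "(2 :: int) ^ y \<le> int n" using S by linarith
  then have G: "2 ^ y \<le> n" by (metis of_nat_le_iff of_nat_numeral of_nat_power)
  note bnd = known_search_bounds[OF kn se _ S C]
  have 1: "wp w' (query sub) (\<lambda>t (R, M). t \<le> 2 * conv_time + 1 \<and> calls_done (K + 2) R M \<and>
    same_progress ?R R \<and> col M 0 = col M0 0 \<and> col M 1 = col M0 1 \<and>
    (\<forall>i < n. col M K i = of_bool (hit n (col M0 0) (col M0 1) (2 ^ y) 0 (i + 2)) \<and>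
       col M (K + 1) i = of_bool (hit n (col M0 0) (col M0 1) (2 ^ y) 1 (i + 2)))) (?R, M0)"
    by (rule wp_query) (use R K n bnd in \<open>auto simp: calls_done_def constants_def\<close>)
  define h where "h \<delta> v \<longleftrightarrow> hit n (col M0 0) (col M0 1) (2 ^ y) \<delta> v" for \<delta> v
  have words: "is_word w' (2 ^ y)" "is_word w' (2 ^ y div 2)"
  proof -
    have "int (2 ^ y) \<le> int n" "int (2 ^ y) div 2 \<le> int n"
      using G by linarith+
    then show "is_word w' (2 ^ y)" "is_word w' (2 ^ y div 2)"
      by (auto intro!: is_word_small)
  qed
  have 2: "wp w' (with_answers update_entry) (\<lambda>t (R, M). t \<le> n * 30 + 5 \<and>
    calls_done (K + 2) R M \<and> same_progress R1 R \<and> col M 0 = col M1 0 \<and>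
    (\<forall>v \<in> {2..n + 1}. col M 1 v = (if h 0 v \<or> h 1 v then col M1 1 v else col M1 1 v + int (2 ^ y))) \<and>
    (\<forall>v. v \<notin> {2..n + 1} \<longrightarrow> col M 1 v = col M1 1 v)) (R1, M1)"
    if "calls_done (K + 2) R1 M1" "same_progress ?R R1" "col M1 0 = col M0 0" "col M1 1 = col M0 1"
      "\<forall>i < n. col M1 K i = of_bool (h 0 (i + 2)) \<and> col M1 (K + 1) i = of_bool (h 1 (i + 2))"
    for R1 M1
    by (rule wp_update) (use that K G bnd in \<open>auto simp: same_progress_def\<close>)
  define rest where "rest = block [with_answers update_entry, Op Quot 15 15 5]"
  define main where "main = Seq (query sub) rest"
  have 3: "wp w' rest (\<lambda>t (R, M). t \<le> n * 30 + 7 \<and> calls_done (K + 2) R M \<and>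
    R 14 = R0 14 \<and> R 15 = 2 ^ y div 2 \<and> col M 0 = col M0 0 \<and>
    search n C S (2 ^ y) (col M 1) \<and> (\<forall>v. v \<notin> {2..n + 1} \<longrightarrow> col M 1 v = col M0 1 v)) (R1, M1)"
    if that1: "calls_done (K + 2) R1 M1" "same_progress ?R R1" "col M1 0 = col M0 0" "col M1 1 = col M0 1"
      "\<forall>i < n. col M1 K i = of_bool (h 0 (i + 2)) \<and> col M1 (K + 1) i = of_bool (h 1 (i + 2))"
    for R1 M1
    unfolding rest_def block.simps wp_Seq wp_Skip
  proof (rule wp_mono[OF 2[OF that1]], clarsimp, goal_cases)
    case (1 t R M)
    have "search n C S (2 ^ y) (col M 1)"
      by (rule search_step[OF kn se]) (use 1 that(4) in \<open>auto simp: h_def\<close>)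
    then show ?case
      using 1 that R(2) words by (auto simp: same_progress_def calls_done_def constants_def)
  qed
  have 4: "wp w' main (\<lambda>t (R, M). t + 1 \<le> round_time \<and> calls_done (K + 2) R M \<and>
    R 14 = R0 14 \<and> R 15 = 2 ^ y div 2 \<and> col M 0 = col M0 0 \<and>
    search n C S (2 ^ y) (col M 1) \<and> (\<forall>v. v \<notin> {2..n + 1} \<longrightarrow> col M 1 v = col M0 1 v)) (?R, M0)"
    unfolding main_def wp_Seq
  proof (rule wp_mono[OF 1], clarify, goal_cases)
    case (1 t R1 M1)
    then show ?case
      by (intro wp_mono[OF 3]) (auto simp: h_def round_time_def)
  qed
  have "search_round sub = Seq (Op Add 6 15 19) main"
    by (simp add: search_round_def main_def rest_def)
  then show ?thesis
    using 4 words R by (auto simp: calls_done_def constants_def elim!: wp_mono)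
qed

definition phase_time :: "nat \<Rightarrow> nat" where
  "phase_time h = (h + 1) * (round_time + 1) + 10"

text \<open>The bound \<open>K \<le> 2 * 2 ^ h\<close> propagates because a phase uses
  \<open>2 * h + 2\<close> columns and \<open>h + 1 \<le> 2 ^ h\<close>. By
  \<open>2 ^ h < n\<close>, fewer than \<open>4 * n\<close> columns are in use afterwards, so
  \<open>stride\<close> suffices and no logarithm has to be computed.\<close>

lemma wp_phase:
  assumes R: "calls_done K R0 M0" "R0 14 = 2 ^ h" "2 ^ h < n"
    and K: "2 \<le> K" "K \<le> 2 * 2 ^ h" and C: "0 \<notin> C"
    and kn: "known n C (2 ^ h) (col M0 0)" and U: "\<And>v. col M0 1 v = 0"
  shows "wp w' (phase sub) (\<lambda>t (R, M). t \<le> phase_time h \<and> (\<exists>K \<ge> 2. K \<le> 2 * 2 ^ Suc h \<and>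
    calls_done K R M) \<and> R 14 = 2 ^ Suc h \<and> R 16 = of_bool (2 ^ Suc h < n) \<and>
    known n C (2 ^ Suc h) (col M 0) \<and> (\<forall>v. col M 1 v = 0)) (R0, M0)"
proof -
  have n: "n \<ge> 2"
  proof -
    have "(1::nat) \<le> 2 ^ h" by simp
    with R(3) show ?thesis by linarith
  qed
  define S :: int where "S = 2 ^ h"
  have S: "S \<le> int n" "1 \<le> S"
    using R(3) of_nat_le_iff[where 'a = int, of "2 ^ h" n] by (auto simp: S_def)
  have hS: "h + 1 \<le> 2 ^ h" by (metis Suc_eq_plus1 Suc_leI less_exp)
  then have stride: "K + 2 * h + 2 \<le> stride" "K + 2 * h + 2 \<le> 2 * 2 ^ Suc h"
    using K R(3) by (auto simp: stride_def)
  \<comment> \<open>With \<open>x\<close> rounds left the intervals have length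
    \<open>2 ^ x\<close>; the loop test \<open>2 ^ x div 2\<close> is zero exactly for
    \<open>x = 0\<close>.\<close>
  define I where "I x s \<longleftrightarrow> (case s of (R, M) \<Rightarrow> x \<le> h \<and> calls_done (K + 2 * (h - x)) R M \<and>
    R 14 = 2 ^ h \<and> R 15 = 2 ^ x div 2 \<and> known n C S (col M 0) \<and> search n C S (2 ^ x) (col M 1) \<and>
    (\<forall>v. v \<notin> {2..n + 1} \<longrightarrow> col M 1 v = 0))" for x and s :: state
  define loop where "loop = While 15 (search_round sub)"
  have 1: "wp w' loop (\<lambda>t s. t \<le> h * (round_time + 1) + 1 \<and> I 0 s) (R0(15 := 2 ^ h div 2), M0)"
    unfolding loop_def
  proof (rule wp_While)
    show "I h (R0(15 := 2 ^ h div 2), M0)"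
      using R kn U S search_init[OF S(2), of "col M0 1" n C]
      by (auto simp: I_def calls_done_def constants_def S_def)
  next
    fix x and s :: state
    assume x: "x < h" and I: "I (Suc x) s"
    obtain R M where s: "s = (R, M)" by fastforce
    let ?K = "K + 2 * (h - Suc x)"
    have "h - x = Suc (h - Suc x)" using x by simp
    then have K2: "?K + 2 = K + 2 * (h - x)" by simp
    have "wp w' (search_round sub) (\<lambda>t (R', M'). t \<le> round_time \<and> calls_done (?K + 2) R' M' \<and>
      R' 14 = R 14 \<and> R' 15 = 2 ^ x div 2 \<and> col M' 0 = col M 0 \<and>
      search n C S (2 ^ x) (col M' 1) \<and> (\<forall>v. v \<notin> {2..n + 1} \<longrightarrow> col M' 1 v = col M 1 v)) (R, M)"
      by (rule wp_round) (use I x s K n C S stride in \<open>auto simp: I_def\<close>)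
    then have "wp w' (search_round sub) (\<lambda>t s'. t \<le> round_time \<and> I x s') s"
      unfolding s K2 by (rule wp_mono) (use I s x in \<open>auto simp: I_def\<close>)
    moreover have "fst s 15 \<noteq> 0" using I s by (simp add: I_def)
    ultimately show "fst s 15 \<noteq> 0 \<and> wp w' (search_round sub) (\<lambda>t s'. t \<le> round_time \<and> I x s') s"
      by blast
  qed (auto simp: I_def)
  define rest where "rest = block [query sub, with_answers final_entry, Op Add 14 14 14, Op Lt 16 14 3]"
  let ?K = "K + 2 * h"
  let ?Q = "\<lambda>R M. calls_done (?K + 2) R M \<and> R 14 = 2 ^ Suc h \<and> R 16 = of_bool (2 ^ Suc h < n) \<and>
    known n C (2 ^ Suc h) (col M 0) \<and> (\<forall>v. col M 1 v = 0)"
  have 2: "wp w' rest (\<lambda>t (R, M). t \<le> 2 * conv_time + n * 40 + 20 \<and> ?Q R M) (R1(6 := 1), M1)"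
    if "I 0 (R1, M1)" for R1 M1
  proof -
    have R1: "calls_done ?K (R1(6 := 1)) M1" "R1 14 = 2 ^ h" and kn1: "known n C S (col M1 0)"
      and se1: "search n C S 1 (col M1 1)" and out: "\<And>v. v \<notin> {2..n + 1} \<Longrightarrow> col M1 1 v = 0"
      using that by (auto simp: I_def calls_done_def constants_def)
    note bnd = known_search_bounds[OF kn1 se1 _ S(1) C]
    define hit' where "hit' \<delta> v \<longleftrightarrow> hit n (col M1 0) (col M1 1) 1 \<delta> v" for \<delta> v
    have query: "wp w' (query sub) (\<lambda>t (R, M). t \<le> 2 * conv_time + 1 \<and> calls_done (?K + 2) R M \<and>
      same_progress (R1(6 := 1)) R \<and> col M 0 = col M1 0 \<and> col M 1 = col M1 1 \<and>
      (\<forall>i < n. col M ?K i = of_bool (hit n (col M1 0) (col M1 1) 1 0 (i + 2)) \<and>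
         col M (?K + 1) i = of_bool (hit n (col M1 0) (col M1 1) 1 1 (i + 2)))) (R1(6 := 1), M1)"
      by (rule wp_query) (use R1 K n stride bnd in auto)
    have final: "wp w' (with_answers final_entry) (\<lambda>t (R, M). t \<le> n * 40 + 5 \<and>
      calls_done (?K + 2) R M \<and> same_progress R2 R \<and>
      (\<forall>v \<in> {2..n + 1}. col M 1 v = 0 \<and> col M 0 v = (if col M2 0 v \<noteq> 0 then col M2 0 v
        else if hit' 0 v then 2 * col M2 1 v + 2 else if hit' 1 v then 2 * col M2 1 v + 3 else 0)) \<and>
      (\<forall>v. v \<notin> {2..n + 1} \<longrightarrow> col M 0 v = col M2 0 v \<and> col M 1 v = col M2 1 v)) (R2, M2)"
      if "calls_done (?K + 2) R2 M2" "col M2 0 = col M1 0" "col M2 1 = col M1 1"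
        "\<forall>i < n. col M2 ?K i = of_bool (hit' 0 (i + 2)) \<and> col M2 (?K + 1) i = of_bool (hit' 1 (i + 2))"
      for R2 M2
      by (rule wp_final) (use that K n stride bnd in auto)
    have "(2 :: int) ^ h \<le> int n" using S by (simp add: S_def)
    then have double: "(2 :: int) ^ h + 2 ^ h \<le> 8 * int n" by linarith
    have less: "(2 * 2 ^ h < int n) = (2 * 2 ^ h < n)"
      using of_nat_less_iff[where 'a = int, of "2 * 2 ^ h" n] by simp
    have words: "is_word w' (2 ^ h + 2 ^ h)" "is_word w' 0" "is_word w' 1"
      using double by (auto intro!: is_word_small)
    show ?thesis
      unfolding rest_def block.simps wp_Seq[of _ "query _"]
    proof (rule wp_mono[OF query], clarify, goal_cases)
      case (1 t2 R2 M2)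
      then have a2: "\<forall>i < n. col M2 ?K i = of_bool (hit' 0 (i + 2)) \<and> col M2 (?K + 1) i = of_bool (hit' 1 (i + 2))"
        by (simp add: hit'_def)
      show ?case
        unfolding wp_Seq[of _ "with_answers _"]
      proof (rule wp_mono[OF final[OF 1(2,4,5) a2]], clarify, goal_cases)
        case (1 t3 R3 M3)
        note 3 = \<open>t2 \<le> 2 * conv_time + 1\<close> \<open>same_progress (R1(6 := 1)) R2\<close>
          \<open>col M2 0 = col M1 0\<close> \<open>col M2 1 = col M1 1\<close>
        have "known n C (2 * S) (col M3 0)"
          by (rule known_double[OF kn1 se1 S(2) C]) (use 1 3 in \<open>auto simp: hit'_def\<close>)
        moreover have "col M3 1 v = 0" for v
          using 1 3 out by (cases "v \<in> {2..n + 1}") auto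
        ultimately show ?case
          using 1 3 R1 less words
          by (auto simp: S_def calls_done_def constants_def same_progress_def)
      qed
    qed
  qed
  define main where "main = Seq loop (Seq (Op Add 6 4 19) rest)"
  have 3: "wp w' main (\<lambda>t (R, M). t + 2 \<le> phase_time h \<and> ?Q R M) (R0(15 := 2 ^ h div 2), M0)"
    unfolding main_def wp_Seq[of _ loop]
  proof (rule wp_mono[OF 1], clarify, goal_cases)
    case (1 t1 R1 M1)
    then have "R1 4 = 1" "R1 19 = 0" by (auto simp: I_def calls_done_def constants_def)
    moreover have "is_word w' 1" by (rule is_word_small) simp
    ultimately show ?case
      using 1 wp_mono[OF 2[OF 1(2)]] by (auto simp: phase_time_def round_time_def elim!: wp_mono)
  qed
  have main_eq: "phase sub = Seq (Op Quot 15 14 5) main"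
    by (simp add: phase_def main_def rest_def loop_def)
  have "0 \<le> S div 2" "S div 2 \<le> int n" using S by linarith+
  then have "is_word w' (2 ^ h div 2)"
    by (intro is_word_small) (simp add: S_def)
  then have "wp w' (phase sub) (\<lambda>t (R, M). t \<le> phase_time h \<and> ?Q R M) (R0, M0)"
    unfolding main_eq using R by (auto simp: calls_done_def constants_def intro!: wp_mono[OF 3])
  then show ?thesis
    by (rule wp_mono) (use K stride in \<open>auto intro!: exI[of _ "?K + 2"]\<close>)
qed

section \<open>Reading the coins, running all phases, writing the output\<close>

lemma wp_coins:
  assumes R: "calls_done 2 R0 M0" "R0 9 = int (length cs)"
    and cs: "length cs \<le> n" "set cs \<subseteq> {1..n}"
    and M0: "\<And>k i. col M0 k i = 0" "\<And>j. j < length cs \<Longrightarrow> M0 (j + 2) = int (cs ! j)"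
  shows "wp w' (downto0 9 coin_entry) (\<lambda>t (R, M). t \<le> n * 10 + 1 \<and> calls_done 2 R M \<and>
    (\<forall>v. col M 0 v = of_bool (v \<in> set cs) \<and> col M 1 v = 0)) (R0, M0)"
proof -
  define I where "I x s \<longleftrightarrow> (case s of (R, M) \<Rightarrow>
    (\<forall>r. r \<notin> {0, 9, 10, 11} \<longrightarrow> R r = R0 r) \<and> (\<forall>a < base. M a = M0 a) \<and>
    col M = (col M0)(0 := \<lambda>v. of_bool (v \<in> set (drop x cs))))" for x and s :: state
  have "wp w' (downto0 9 coin_entry) (\<lambda>t (R, M). t \<le> length cs * (8 + 2) + 1 \<and> I 0 (R, M)) (R0, M0)"
  proof (rule wp_downto0[where I = I and B = 8])
    show "I (length cs) (R0, M0)" by (auto simp: I_def M0 fun_eq_iff)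
    show "is_word w' (int (length cs))" using cs by (intro is_word_small) simp
    show "R 4 = 1" if "I x (R, M)" for x R M
      using that R by (auto simp: I_def calls_done_def constants_def)
    fix x R M
    assume x: "x < length cs" and I: "I (Suc x) (R, M)"
    have regs: "R (Suc 0) = int stride" "R 4 = 1" "R 5 = 2" "R 7 = int base"
      using I R by (auto simp: I_def calls_done_def constants_def)
    have word: "is_word w' (int x + 2)" using x cs by (intro is_word_small) simp
    have drop: "drop x cs = cs ! x # drop (Suc x) cs" using x by (simp add: Cons_nth_drop_Suc)
    have coin: "cs ! x \<in> {1..n}" using x cs(2) by (meson nth_mem subsetD)
    \<comment> \<open>The coins lie below \<open>base\<close>, so marking entries in the matrix has
      left them intact.\<close>
    have "M (Suc (Suc x)) = int (cs ! x)"
      using I x cs M0(2)[of x] by (auto simp: I_def base_def)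
    moreover have "nat (int x + 2) = Suc (Suc x)" by (simp add: nat_add_distrib)
    moreover have "int (cs ! x) \<le> max_index" using coin max_index_ge by auto
    moreover have "0 < stride" by (simp add: stride_def)
    ultimately show "wp w' coin_entry (\<lambda>t (R', M'). t \<le> 8 \<and> R' 9 = int x \<and> I x (R', M'))
      (R(9 := int x), M)"
      using I word by (simp add: coin_entry_def wp_store_entry regs)
        (auto simp: I_def drop fun_eq_iff)
  qed (rule R)
  then show ?thesis
    by (rule wp_mono) (use R cs M0 in \<open>auto simp: I_def calls_done_def constants_def\<close>)
qed

lemma wp_output:
  assumes R: "calls_done K R0 M0" "R0 9 = int n"
    and F: "\<And>v. v \<in> {1..n} \<Longrightarrow> \<bar>col M0 0 v\<bar> \<le> int n"
  shows "wp w' (downto0 9 output_entry) (\<lambda>t (R, M). t \<le> n * 12 + 1 \<and>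
    (\<forall>i < n. M i = (if col M0 0 (i + 1) = 0 then - 1 else col M0 0 (i + 1)))) (R0, M0)"
proof -
  define I where "I x s \<longleftrightarrow> (case s of (R, M) \<Rightarrow>
    (\<forall>r. r \<notin> {0, 9, 10, 11} \<longrightarrow> R r = R0 r) \<and> col M = col M0 \<and>
    (\<forall>i. x \<le> i \<and> i < n \<longrightarrow> M i = (if col M0 0 (i + 1) = 0 then - 1 else col M0 0 (i + 1))))"
    for x and s :: state
  have "wp w' (downto0 9 output_entry) (\<lambda>t (R, M). t \<le> n * (10 + 2) + 1 \<and> I 0 (R, M)) (R0, M0)"
  proof (rule wp_downto0[where I = I and B = 10])
    show "I n (R0, M0)" by (auto simp: I_def)
    show "is_word w' (int n)" by (intro is_word_small) simp
    show "R 4 = 1" if "I x (R, M)" for x R M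
      using that R by (auto simp: I_def calls_done_def constants_def)
    fix x R M
    assume x: "x < n" and I: "I (Suc x) (R, M)"
    have regs: "R (Suc 0) = int stride" "R 4 = 1" "R 7 = int base"
      using I R by (auto simp: I_def calls_done_def constants_def)
    have words: "is_word w' (int x + 1)" "is_word w' (- 1)" using x by (auto intro!: is_word_small)
    have "nat (int x + 1) = Suc x" by (simp add: nat_add_distrib)
    moreover have "int x + 1 \<le> max_index" using x max_index_ge by linarith
    moreover have "0 < stride" by (simp add: stride_def)
    \<comment> \<open>The output overwrites input cells but stays below \<open>base\<close>.\<close>
    moreover have "col (M(x := y)) = col M" for y
      using x by (auto simp: col_def base_def fun_eq_iff)
    moreover have "col M = col M0" using I by (simp add: I_def)
    moreover have "x \<le> i \<longleftrightarrow> i = x \<or> Suc x \<le> i" for i by auto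
    ultimately show "wp w' output_entry (\<lambda>t (R', M'). t \<le> 10 \<and> R' 9 = int x \<and> I x (R', M'))
      (R(9 := int x), M)"
      using I words by (simp add: output_entry_def wp_load_entry regs) (auto simp: I_def)
  qed (rule R)
  then show ?thesis by (rule wp_mono) (auto simp: I_def)
qed

text \<open>The hypothesis on \<open>L\<close> makes it the least exponent with
  \<open>n \<le> 2 ^ L\<close>, which is the number of phases. For \<open>n = 1\<close> it is 0 and
  the subroutine is never called; this matters because the label \<open>- 2\<close> would then
  exceed the bound on entries.\<close>

lemma wp_phases:
  assumes R: "calls_done 2 R0 M0" "R0 14 = 1" "R0 16 = of_bool (1 < n)" and C: "0 \<notin> C"
    and kn: "known n C 1 (col M0 0)" "\<And>v. col M0 1 v = 0"
    and L: "\<And>h. 2 ^ h < n \<longleftrightarrow> h < L"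
  shows "wp w' (While 16 (phase sub)) (\<lambda>t (R, M). t \<le> L * (phase_time L + 1) + 1 \<and>
    (\<exists>K. calls_done K R M) \<and> known n C (2 ^ L) (col M 0)) (R0, M0)"
proof -
  define I where "I x s \<longleftrightarrow> (case s of (R, M) \<Rightarrow> \<exists>h. h + x = L \<and>
    (\<exists>K \<ge> 2. K \<le> 2 * 2 ^ h \<and> calls_done K R M) \<and> R 14 = 2 ^ h \<and> R 16 = of_bool (2 ^ h < n) \<and>
    known n C (2 ^ h) (col M 0) \<and> (\<forall>v. col M 1 v = 0))" for x and s :: state
  have "wp w' (While 16 (phase sub)) (\<lambda>t s. t \<le> L * (phase_time L + 1) + 1 \<and> I 0 s) (R0, M0)"
  proof (rule wp_While)
    show "I L (R0, M0)" using R kn by (auto simp: I_def)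
    show "fst s 16 = 0" if "I 0 s" for s using that L by (auto simp: I_def)
    fix x and s :: state
    assume x: "x < L" and I: "I (Suc x) s"
    obtain R M where s: "s = (R, M)" by fastforce
    from I obtain h K where h: "h + Suc x = L" and K: "2 \<le> K" "K \<le> 2 * 2 ^ h" "calls_done K R M"
      and h_facts: "R 14 = 2 ^ h" "R 16 = of_bool (2 ^ h < n)" "known n C (2 ^ h) (col M 0)"
        "\<forall>v. col M 1 v = 0"
      unfolding I_def s by blast
    have less: "2 ^ h < n" using L h by simp
    have "phase_time h \<le> phase_time L"
      unfolding phase_time_def using h by (intro add_mono mult_mono) auto
    moreover have "I x (R', M')" if "\<exists>K \<ge> 2. K \<le> 2 * 2 ^ Suc h \<and> calls_done K R' M'" "R' 14 = 2 ^ Suc h"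
      "R' 16 = of_bool (2 ^ Suc h < n)" "known n C (2 ^ Suc h) (col M' 0)" "\<forall>v. col M' 1 v = 0"
      for R' M'
      unfolding I_def prod.case using that h by (intro exI[of _ "Suc h"]) simp
    ultimately have "wp w' (phase sub) (\<lambda>t s'. t \<le> phase_time L \<and> I x s') (R, M)"
      using h_facts(4)
      by (intro wp_mono[OF wp_phase[OF K(3) h_facts(1) less K(1,2) C h_facts(3)]]) auto
    then show "fst s 16 \<noteq> 0 \<and> wp w' (phase sub) (\<lambda>t s'. t \<le> phase_time L \<and> I x s') s"
      using h_facts(2) less s by simp
  qed
  then show ?thesis by (rule wp_mono) (auto simp: I_def)
qed

section \<open>Correctness and running time of the whole program\<close>

definition total_time :: "nat \<Rightarrow> nat" where
  "total_time L = L * (phase_time L + 1) + 22 * n + 40"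

lemma wp_coin_change:
  assumes cs: "distinct cs" "set cs \<subseteq> {1..n}" and L: "\<And>h. 2 ^ h < n \<longleftrightarrow> h < L"
  shows "wp w' (coin_change sub) (\<lambda>t (R, M). t \<le> total_time L \<and>
    (\<forall>i < n. M i = enat_code (min_coins (set cs) (i + 1))))
    (init_state (int n # int (length cs) # map int cs))"
proof -
  define xs where "xs = int n # int (length cs) # map int cs"
  define M0 where "M0 = snd (init_state xs)"
  have len: "length cs \<le> n"
    using distinct_card[OF cs(1)] card_mono[OF _ cs(2)] by simp
  have C: "0 \<notin> set cs" using cs(2) by auto
  define R0 :: "nat \<Rightarrow> int" where "R0 = (\<lambda>r. if r = 1 then int stride else if r = 2 then int base + 2 else
    if r = 3 then int n else if r = 4 then 1 else if r = 5 then 2 else if r = 7 then int base else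
    if r = 8 then int base + 1 else if r = 9 then int (length cs) else if r = 10 then 8 else
    if r = 18 then int (length cs) else 0)"
  have init: "wp w' initialize (\<lambda>t s. t \<le> 20 \<and> s = (R0, M0)) (init_state xs)"
  proof -
    have "M0 0 = int n" "M0 1 = int (length cs)"
      by (simp_all add: M0_def xs_def init_state_def)
    moreover have "init_state xs = ((\<lambda>_. 0), M0)" by (simp add: M0_def init_state_def)
    moreover have "is_word w' 1" "is_word w' 2" "is_word w' 8" "is_word w' (int n + 2)"
      "is_word w' (int n + 2 + 1)" "is_word w' (int n + 2 + 1 + 1)" "is_word w' (int n + int n)"
      "is_word w' (int n + int n + (int n + int n))" "is_word w' (int n + int n + (int n + int n) + 8)"
      "is_word w' (int (length cs))"
      using len by (auto intro!: is_word_small)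
    ultimately show ?thesis
      by (simp add: initialize_def) (auto simp: R0_def base_def stride_def fun_eq_iff)
  qed
  \<comment> \<open>The input ends before \<open>base\<close>, so the matrix starts out
    zero.\<close>
  have col0: "col M0 k i = 0" for k i
    using len by (auto simp: M0_def col_def init_state_def xs_def base_def)
  have coins: "wp w' (downto0 9 coin_entry) (\<lambda>t (R, M). t \<le> n * 10 + 1 \<and> calls_done 2 R M \<and>
    (\<forall>v. col M 0 v = of_bool (v \<in> set cs) \<and> col M 1 v = 0)) (R0, M0)"
    using wp_coins[of R0 M0 cs] len cs col0
    by (simp add: calls_done_def constants_def R0_def M0_def init_state_def xs_def)
  have words: "is_word w' 0" "is_word w' 1" "is_word w' (int n)"
    by (auto intro!: is_word_small)
  define output_com where "output_com = block [Op Add 9 3 19, downto0 9 output_entry]"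
  let ?P = "\<lambda>M :: nat \<Rightarrow> int. \<forall>i < n. M i = enat_code (min_coins (set cs) (i + 1))"
  have out: "wp w' output_com (\<lambda>t (R, M). t \<le> n * 12 + 3 \<and> ?P M) (R1, M1)"
    if "calls_done K R1 M1" "known n (set cs) (2 ^ L) (col M1 0)" for K R1 M1
  proof -
    have "n \<le> 2 ^ L" using L[of L] by simp
    then have "int n \<le> 2 ^ L" by (metis of_nat_le_iff of_nat_numeral of_nat_power)
    note final = known_final[OF that(2) this C]
    have bnd: "\<bar>col M1 0 v\<bar> \<le> int n" if "v \<in> {1..n}" for v
      using known_bounds[OF \<open>known n (set cs) (2 ^ L) (col M1 0)\<close> C, of v] that by auto
    have "calls_done K (R1(9 := int n)) M1"
      using that(1) by (auto simp: calls_done_def constants_def)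
    then have "wp w' (downto0 9 output_entry) (\<lambda>t (R, M). t \<le> n * 12 + 1 \<and>
      (\<forall>i < n. M i = (if col M1 0 (i + 1) = 0 then - 1 else col M1 0 (i + 1)))) (R1(9 := int n), M1)"
      by (rule wp_output) (use bnd in auto)
    then have "wp w' (downto0 9 output_entry) (\<lambda>t (R, M). t \<le> n * 12 + 1 \<and> ?P M) (R1(9 := int n), M1)"
      by (rule wp_mono) (use final in auto)
    then show ?thesis
      using words that(1) unfolding output_com_def
      by (auto simp: calls_done_def constants_def elim!: wp_mono)
  qed
  define main where "main = Seq (While 16 (phase sub)) output_com"
  have main: "wp w' main (\<lambda>t (R, M). t \<le> L * (phase_time L + 1) + n * 12 + 4 \<and> ?P M)
      (R1(14 := 1, 16 := of_bool (1 < n)), M1)"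
    if "calls_done 2 R1 M1" "\<forall>v. col M1 0 v = of_bool (v \<in> set cs) \<and> col M1 1 v = 0" for R1 M1
    unfolding main_def wp_Seq
  proof (rule wp_mono[OF wp_phases[OF _ _ _ C _ _ L]], goal_cases)
    case 4
    show ?case by (rule known_init) (use C that(2) in auto)
  next
    case (6 t s)
    then obtain R2 M2 K where "s = (R2, M2)" "calls_done K R2 M2" "known n (set cs) (2 ^ L) (col M2 0)"
      "t \<le> L * (phase_time L + 1) + 1" by auto
    then show ?case by (auto intro!: wp_mono[OF out])
  qed (use that in \<open>auto simp: calls_done_def constants_def\<close>)
  have coin_change_eq: "coin_change sub = Seq initialize (Seq (downto0 9 coin_entry) (Seq (Op Add 14 4 19)
      (Seq (Op Lt 16 14 3) main)))"
    by (simp add: coin_change_def main_def output_com_def)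
  have "wp w' (Seq (Op Add 14 4 19) (Seq (Op Lt 16 14 3) main))
      (\<lambda>t (R, M). t \<le> L * (phase_time L + 1) + n * 12 + 6 \<and> ?P M) (R1, M1)"
    if "calls_done 2 R1 M1" "\<forall>v. col M1 0 v = of_bool (v \<in> set cs) \<and> col M1 1 v = 0" for R1 M1
    using main[OF that] words that(1)
    by (auto simp: calls_done_def constants_def elim!: wp_mono)
  note rest = this
  define rest_com where "rest_com = Seq (Op Add 14 4 19) (Seq (Op Lt 16 14 3) main)"
  have "wp w' (Seq initialize (Seq (downto0 9 coin_entry) rest_com))
    (\<lambda>t (R, M). t \<le> total_time L \<and> ?P M) (init_state xs)"
    unfolding wp_Seq
  proof (rule wp_mono[OF init], clarify, rule wp_mono[OF coins], clarify, goal_cases)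
    case (1 t1 t2 R1 M1)
    then show ?case
      unfolding rest_com_def by (intro wp_mono[OF rest]) (auto simp: total_time_def)
  qed
  then show ?thesis
    by (simp only: xs_def rest_com_def coin_change_eq)
qed

text \<open>\<open>\<tau>\<close> stands for the time of a convolution and \<open>u\<close> for
  \<open>log 2 n\<close>. There are \<open>L \<le> 2 * u\<close> phases with at most
  \<open>L + 1 \<le> 3 * u\<close> queries each, and \<open>n \<le> \<tau>\<close> absorbs the
  linear work.\<close>

lemma total_time_le:
  fixes \<tau> u :: real
  assumes "real n \<le> \<tau>" "real Tm \<le> \<tau>" "1 \<le> \<tau>" "real L \<le> 2 * u" "1 \<le> u"
  shows "real (total_time L) \<le> (6 * (189 + 2 * real (reg_bound sub)) + 84) * (\<tau> * u\<^sup>2)"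
proof -
  \<comment> \<open>\<open>round_time + 1\<close> is
    \<open>120 * n + 8 * Tm + 2 * reg_bound sub + 61\<close>, and
    \<open>120 + 8 + 61 = 189\<close>.\<close>
  define A where "A = 189 + 2 * real (reg_bound sub)"
  have A: "0 \<le> A" by (simp add: A_def)
  have "real (reg_bound sub) * 1 \<le> real (reg_bound sub) * \<tau>"
    using assms by (intro mult_left_mono) auto
  then have round: "real round_time + 1 \<le> A * \<tau>"
    using assms by (simp add: A_def round_time_def conv_time_def algebra_simps)
  have pos: "1 \<le> \<tau> * u" "\<tau> * u \<le> \<tau> * u\<^sup>2" "\<tau> \<le> \<tau> * u"
    using assms mult_mono[of 1 \<tau> 1 u] by (auto simp: power2_eq_square)
  have "(real L + 1) * (real round_time + 1) \<le> (3 * u) * (A * \<tau>)"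
    using assms round by (intro mult_mono) auto
  then have phase: "real (phase_time L) + 1 \<le> (3 * A + 11) * (\<tau> * u)"
    using pos(1) by (simp add: phase_time_def algebra_simps)
  have "real L * (real (phase_time L) + 1) \<le> (2 * u) * ((3 * A + 11) * (\<tau> * u))"
    using assms phase by (intro mult_mono) auto
  also have "\<dots> = (6 * A + 22) * (\<tau> * u\<^sup>2)"
    by (simp add: power2_eq_square algebra_simps)
  finally have "real (total_time L) \<le> (6 * A + 22) * (\<tau> * u\<^sup>2) + 22 * real n + 40"
    by (simp add: total_time_def algebra_simps)
  moreover have "22 * real n + 40 \<le> 62 * (\<tau> * u\<^sup>2)"
    using assms pos by linarith
  ultimately have "real (total_time L) \<le> (6 * A + 84) * (\<tau> * u\<^sup>2)"
    by (simp add: algebra_simps)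
  then show ?thesis by (simp add: A_def)
qed

end

section \<open>Word lengths and the number of phases\<close>

lemma word_size_wide:
  assumes "n > 0"
  shows "(2 ^ (word_size \<kappa> n - 1) + 4 * int n + 10) * (8 * int n + 16) \<le> 2 ^ (word_size (\<kappa> + 8) n - 1)"
proof -
  define l where "l = nat \<lceil>log 2 (real n + 2)\<rceil>"
  have "real n + 2 = 2 powr log 2 (real n + 2)" by simp
  also have "\<dots> \<le> 2 powr real l"
    unfolding l_def by (intro powr_mono) linarith+
  also have "\<dots> = real (2 ^ l)" by (simp add: powr_realpow)
  finally have "real (n + 2) \<le> real (2 ^ l)" by simp
  then have n: "n + 2 \<le> 2 ^ l" by (rule of_nat_le_iff[THEN iffD1])
  have l: "2 \<le> l"
  proof (rule ccontr)
    assume "\<not> 2 \<le> l"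
    then have "(2 :: nat) ^ l \<le> 2 ^ 1" by (intro power_increasing) auto
    with n assms show False by simp
  qed
  have n': "int n + 2 \<le> 2 ^ l"
    using n by (metis of_nat_add of_nat_le_iff of_nat_numeral of_nat_power)
  have l4: "(4 :: int) \<le> 2 ^ l" using l power_increasing[of 2 l "2 :: int"] by simp
  define k where "k = (2 :: int) ^ (\<kappa> * l)"
  define x where "x = (2 :: int) ^ l"
  have k: "1 \<le> k" by (simp add: k_def)
  have "(2 :: int) ^ (\<kappa> * l - 1) \<le> k" unfolding k_def by (intro power_increasing) auto
  moreover have "10 + 4 * int n \<le> 6 * x * k"
  proof -
    have "10 + 4 * int n \<le> 6 * x" using n' l4 by (simp add: x_def)
    also have "\<dots> \<le> 6 * x * k" using k by (simp add: x_def)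
    finally show ?thesis .
  qed
  moreover have "k \<le> x * k" using k by (simp add: x_def)
  ultimately have "2 ^ (\<kappa> * l - 1) + 4 * int n + 10 \<le> 7 * x * k" by linarith
  moreover have "8 * int n + 16 \<le> 8 * x" using n' by (simp add: x_def)
  ultimately have "(2 ^ (\<kappa> * l - 1) + 4 * int n + 10) * (8 * int n + 16) \<le> (7 * x * k) * (8 * x)"
    using k by (intro mult_mono) (auto simp: x_def)
  also have "\<dots> \<le> 64 * (k * x * x)" using k by (simp add: x_def algebra_simps)
  also have "\<dots> = k * x * x * 2 ^ 6" by simp
  also have "\<dots> = 2 ^ (\<kappa> * l + l + l + 6)"
    unfolding k_def x_def power_add ..
  \<comment> \<open>Since \<open>l \<ge> 2\<close>, \<open>2 * l + 6 \<le> 8 * l - 1\<close>, so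
    raising \<open>\<kappa>\<close> by 8 makes room for the two factors \<open>2 ^ l\<close> and the
    constant \<open>2 ^ 6\<close>.\<close>
  also have "\<dots> \<le> 2 ^ ((\<kappa> + 8) * l - 1)"
  proof (intro power_increasing)
    have "(\<kappa> + 8) * l = \<kappa> * l + 8 * l" by (rule add_mult_distrib)
    then show "\<kappa> * l + l + l + 6 \<le> (\<kappa> + 8) * l - 1" using l by linarith
  qed simp
  finally show ?thesis by (simp add: word_size_def l_def)
qed

text \<open>Powers of 2 increase, so the least exponent that reaches \<open>n\<close> is a
  threshold; it is the number of phases.\<close>

lemma power_less_iff_less_Least: "(2 :: nat) ^ h < n \<longleftrightarrow> h < (LEAST l. n \<le> 2 ^ l)"
proof -
  have ex: "n \<le> 2 ^ n" using less_exp[of n] by simp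
  have "n \<le> 2 ^ h \<longleftrightarrow> (LEAST l. n \<le> 2 ^ l) \<le> h"
  proof
    assume "(LEAST l. n \<le> 2 ^ l) \<le> h"
    then have "(2 :: nat) ^ (LEAST l. n \<le> 2 ^ l) \<le> 2 ^ h" by (intro power_increasing) auto
    with LeastI[of "\<lambda>l. n \<le> 2 ^ l", OF ex] show "n \<le> 2 ^ h" by linarith
  qed (rule Least_le)
  then show ?thesis by (meson not_le)
qed

theorem theorem9:
  fixes T :: "nat \<Rightarrow> real" and \<gamma> :: nat
  assumes "\<gamma> \<ge> 1"
    and "solvable_in_time (MonoConvolution \<gamma>) T"
  shows "\<exists>T'. T' \<in> O(\<lambda>n. T n * (log 2 (real n))\<^sup>2) \<and> solvable_in_time CoinChange T'"
proof -
  obtain \<kappa> sub where all: "\<forall>n > 0. \<forall>(xs, ys) \<in> MonoConvolution \<gamma> n.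
      \<exists>t. computes (word_size \<kappa> n) sub xs t ys \<and> real t \<le> T n"
    using assms(2) unfolding solvable_in_time_def by blast
  have solves: "\<exists>t. computes (word_size \<kappa> n) sub (int n # a @ b @ c) t (mono_conv a b c) \<and>
      real t \<le> T n"
    if "n > 0" "length a = n" "length b = n" "length c = n"
      "\<forall>x \<in> set a \<union> set b \<union> set c. \<bar>x\<bar> \<le> int n ^ \<gamma>" for n a b c
  proof -
    have "(int n # a @ b @ c, mono_conv a b c) \<in> MonoConvolution \<gamma> n"
      unfolding MonoConvolution_def using that by blast
    with all that(1) show ?thesis by blast
  qed
  \<comment> \<open>Steps are counted by natural numbers, so the real bound can be rounded
    down.\<close>
  define Tm where "Tm n = nat \<lfloor>T n\<rfloor>" for n
  define L where "L n = (LEAST l. n \<le> 2 ^ l)" for n :: nat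
  define T' where "T' n = real (coin_machine.total_time n (Tm n) sub (L n))" for n
  have machine: "coin_machine n (word_size \<kappa> n) (word_size (\<kappa> + 8) n) \<gamma> (Tm n) sub" if "n > 0" for n
  proof
    fix a b c :: "int list"
    assume "length a = n" "length b = n" "length c = n" "\<forall>x \<in> set a \<union> set b \<union> set c. \<bar>x\<bar> \<le> int n ^ \<gamma>"
    from solves[OF that this]
    show "\<exists>t. computes (word_size \<kappa> n) sub (int n # a @ b @ c) t (mono_conv a b c) \<and> t \<le> Tm n"
      unfolding Tm_def by (auto simp: le_nat_floor)
  qed (use that assms(1) word_size_wide in auto)
  have "T' \<in> O(\<lambda>n. T n * (log 2 (real n))\<^sup>2)"
  proof (rule bigoI)
    show "\<forall>\<^sub>F n in at_top. norm (T' n) \<le>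
      (6 * (189 + 2 * real (reg_bound sub)) + 84) * norm (T n * (log 2 (real n))\<^sup>2)"
      \<comment> \<open>From 2 on, \<open>log 2 n\<close> is at least 1 and the lower bound on the
        time of a convolution is available.\<close>
      using eventually_ge_at_top[of 2]
    proof eventually_elim
      case (elim n)
      interpret coin_machine n "word_size \<kappa> n" "word_size (\<kappa> + 8) n" \<gamma> "Tm n" sub
        using elim by (intro machine) simp
      have "int n \<le> int n ^ \<gamma>" using assms(1) elim by (intro self_le_power) auto
      then have "2 \<le> int n ^ \<gamma>" using elim by linarith
      then obtain t where t: "computes (word_size \<kappa> n) sub
          (int n # replicate n 2 @ replicate n 2 @ replicate n 2) t
          (mono_conv (replicate n 2) (replicate n 2) (replicate n 2))" "real t \<le> T n"
        using solves[of n "replicate n 2" "replicate n 2" "replicate n 2"] elim by auto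
      have "n \<le> t"
        using t(1) MonoConvolution_time_lower_bound[OF _ elim]
        by (auto simp: computes_def mono_conv_def)
      with t(2) have T: "real n \<le> T n" by simp
      have log: "1 \<le> log 2 (real n)" using elim by (simp add: le_log_iff)
      have "real (L n) \<le> 2 * log 2 (real n)"
      \<comment> \<open>For \<open>L n = l + 1\<close>, minimality gives \<open>2 ^ l < n\<close>,
        so \<open>L n < log 2 n + 1 \<le> 2 * log 2 n\<close>.\<close>
      proof (cases "L n")
        case (Suc l)
        then have "2 ^ l < n" using power_less_iff_less_Least[of l n] by (simp add: L_def)
        then have "real l < log 2 (real n)"
          by (simp add: less_log_of_power)
        with Suc log show ?thesis by simp
      qed (use log in simp)
      moreover have "real (Tm n) \<le> T n" using T by (simp add: Tm_def)
      moreover have "1 \<le> T n" using T elim by simp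
      ultimately have "T' n \<le> (6 * (189 + 2 * real (reg_bound sub)) + 84) * (T n * (log 2 (real n))\<^sup>2)"
        unfolding T'_def using T log by (intro total_time_le) auto
      then show ?case using T by (simp add: T'_def)
    qed
  qed
  moreover have "solvable_in_time CoinChange T'"
    unfolding solvable_in_time_def
  proof (intro exI allI impI ballI, clarify)
    fix n :: nat and xs ys
    assume n: "0 < n" and "(xs, ys) \<in> CoinChange n"
    then obtain cs where cs: "distinct cs" "set cs \<subseteq> {1..n}"
      and xs: "xs = int n # int (length cs) # map int cs"
      and ys: "ys = map (\<lambda>v. enat_code (min_coins (set cs) v)) [1..<Suc n]"
      unfolding CoinChange_def by blast
    interpret coin_machine n "word_size \<kappa> n" "word_size (\<kappa> + 8) n" \<gamma> "Tm n" sub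
      using n by (rule machine)
    obtain t R M where "exec (word_size (\<kappa> + 8) n) (coin_change sub) (init_state xs) t (R, M)"
      "t \<le> total_time (L n)" "\<forall>i < n. M i = enat_code (min_coins (set cs) (i + 1))"
      using wp_coin_change[OF cs, of "L n"] unfolding wp_def xs L_def
      by (auto simp: power_less_iff_less_Least)
    moreover have "length cs \<le> n"
      using distinct_card[OF cs(1)] card_mono[OF _ cs(2)] by simp
    then have "\<forall>x \<in> set xs. is_word (word_size (\<kappa> + 8) n) x"
      using cs(2) unfolding xs by (auto intro!: is_word_small)
    ultimately show "\<exists>t. computes (word_size (\<kappa> + 8) n) (coin_change sub) xs t ys \<and> real t \<le> T' n"
      unfolding computes_def T'_def ys by (auto simp: nth_append simp del: upt_Suc)
  qed
  ultimately show ?thesis by blast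
qed

end
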